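(* Suppose that for every $T\subseteq[n]$ with $|T|=\lfloor s/2\rfloor$ the column submatrix $A_{:T}$ has full row rank, and let $\gamma>0$ be defined by $\gamma^2=\min_{|T|=\lfloor s/2\rfloor}\lambda_{\min}(A_{:T}A_{:T}^\top)$. Let $c_1,c_2>0$ be the constants used in iPAL, let $\mu>0$, put $c_3:=(2c_1+\mu+2)/\gamma$ and $c_4:=(2c_1+\mu)/\gamma$, and let $\rho\ge\max\{2/\gamma^2,\ 8(c_3^2+c_4^2)/\mu\}$. Let $\{(u^k,z^k)\}_{k\in\mathbb{N}}$ be a sequence generated by iPAL. Then the whole sequence converges to a P-stationary pair $(u^*,z^* )$ of the problem $$\min_{w,\xi}\ \tfrac12\|w\|^2+\lambda J(\xi)+\delta_{\mathbb{S}}(w)\quad\text{s.t.}\quad Aw+\mathbf 1=\xi .$$ Furthermore, $u^*$ is a strict local minimizer of this problem.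
   Context: Setting: $m,n,s$ are positive integers with $s\le n$, $\lambda>0$, and $A\in\mathbb{R}^{m\times n}$ is the data matrix whose $i$-th row is $-y_i[x_i^\top,1]$, with $x_i\in\mathbb{R}^{n-1}$, $y_i\in\{1,-1\}$. $[n]=\{1,\dots,n\}$; for an index set $T$, $\overline T$ is its complement, $w_T$ the subvector and $A_{:T}$ the submatrix of columns indexed by $T$. $\mathbf 1$ is the all-ones vector; $\|w\|_0$ is the number of nonzero entries of $w$; $\mathbb{S}:=\{w\in\mathbb{R}^n:\|w\|_0\le s\}$ with indicator function $\delta_{\mathbb{S}}$ ($0$ on $\mathbb{S}$, $+\infty$ off it). $J(\xi):=\sum_{i=1}^m h(\xi_i)$ for $\xi\in\mathbb{R}^m$, with $h(t)=1$ if $t>0$, $h(t)=0$ if $t\le0$. Write $u=[w;\xi]\in\mathbb{R}^{n+m}$, $u^k=[w^k;\xi^k]$. $\mathrm{Proj}_{\mathbb{S}}(w)$ is the set of Euclidean nearest points of $\mathbb{S}$ to $w$. $\mathrm{Prox}_{\beta\lambda J(\cdot)}(\xi):=\arg\min_{q}\{\lambda J(q)+\frac1{2\beta}\|q-\xi\|^2\}$ and $\Phi_{\beta\lambda J(\cdot)}(\xi):=\min_q\{\lambda J(q)+\frac1{2\beta}\|q-\xi\|^2\}$. $\mathcal T_s(w)$ is the collection of all sets of $s$ indices giving the $s$ largest entries of $|w|$ in absolute value. P-stationary pair: $(u^*,z^* )$ with $u^*=[w^*;\xi^*]$, $z^*\in\mathbb{R}^m$, such that for some $\alpha,\beta>0$: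 $w^*\in\mathrm{Proj}_{\mathbb{S}}(w^*-\alpha(w^*+A^\top z^* ))$, $\xi^*\in\mathrm{Prox}_{\beta\lambda J(\cdot)}(\xi^*+\beta z^* )$, $Aw^*+\mathbf 1-\xi^*=0$. For $\rho,\mu>0$ let $$\mathcal M_{\rho,\mu}(u,z,v):=g(u,z,v)+\delta_{\mathbb{S}}(w)+\lambda J(\xi),$$ $$g(u,z,v):=\tfrac12\|w\|^2+\langle z,Aw+\mathbf 1-\xi\rangle+\tfrac\rho2\|Aw+\mathbf 1-\xi\|^2+\tfrac\mu2\|w-v\|^2,$$ and $g_k(u):=g(u,z^k,w^k)$. Residuals (with fixed constants $\alpha,\beta>0$): for $u=[w;\xi]$ pick $T\in\mathcal T_s(w-\alpha\nabla_w g_k(u))$ and let $\Gamma=\{i\in[m]:[\xi-\beta\nabla_\xi g_k(u)]_i\in(-\infty,0]\cup[\sqrt{2\beta\lambda},\infty)\}$; then $\mathcal R_1(u)=\|[(\nabla_w g_k(u))_T;\,w_{\overline T}]\|$, $\mathcal R_2(u)=\|[(\nabla_\xi g_k(u))_\Gamma;\,\xi_{\overline\Gamma}]\|$, $\mathcal R_3(u)=\frac\beta2\|\nabla_\xi g_k(u)\|^2+\lambda J(\xi)-\Phi_{\beta\lambda J(\cdot)}(\xi-\beta\nabla_\xi g_k(u))$. Algorithm iPAL: given constants $c_1,c_2>0$, an initial point $(u^0,z^0)$ and a positive sequence $\vartheta_k\to0$, for $k=0,1,\dots$: (1) find $u^{k+1}$ satisfying $\mathcal M_{\rho,\mu}(u^{k+1},z^k,w^k)\le\mathcal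 M_{\rho,\mu}(u^k,z^k,w^k)$, $\|w^{k+1}\|_0\le s$, $\mathcal R_1(u^{k+1})\le c_1\|w^{k+1}-w^k\|$, $\mathcal R_2(u^{k+1})\le c_2\|w^{k+1}-w^k\|^2$, $\mathcal R_3(u^{k+1})\le\vartheta_k$; (2) set $z^{k+1}=z^k+\rho(Aw^{k+1}+\mathbf 1-\xi^{k+1})$. *)

theory Defs
  imports "HOL-Analysis.Analysis"
begin

text \<open>
  Sample \<open>i\<close> has label \<open>y $ i\<close> and features \<open>x i j\<close> for \<open>j \<noteq> b\<close>; the index \<open>b\<close> is the position
  of the bias column (the last one in the usual ordering), so \<open>x i b\<close> is never read and
  \<open>x i\<close> stands for a vector of dimension \<open>CARD('n) - 1\<close>.
\<close>
definition data_matrix :: "'n \<Rightarrow> ('m \<Rightarrow> 'n \<Rightarrow> real) \<Rightarrow> real^'m \<Rightarrow> real^'n^'m" where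
  "data_matrix b x y = (\<chi> i j. - (y $ i) * (if j = b then 1 else x i j))"

text \<open>
  The column submatrix \<open>A\<^bsub>:T\<^esub>\<close>, with the columns outside \<open>T\<close> set to zero instead of being
  deleted; this changes neither its rank nor the product \<open>A\<^bsub>:T\<^esub> A\<^bsub>:T\<^esub>\<^sup>\<top>\<close>.
\<close>
definition col_submatrix :: "real^'n^'m \<Rightarrow> 'n set \<Rightarrow> real^'n^'m" where
  "col_submatrix A T = (\<chi> i j. if j \<in> T then A $ i $ j else 0)"

definition eigenvalues :: "real^'n^'n \<Rightarrow> real set" where
  "eigenvalues B = {e. \<exists>v. v \<noteq> 0 \<and> B *v v = e *\<^sub>R v}"

definition lambda_min :: "real^'n^'n \<Rightarrow> real" where
  "lambda_min B = Min (eigenvalues B)"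

definition sparse_set :: "nat \<Rightarrow> (real^'n) set" where
  "sparse_set s = {w. card {i. w $ i \<noteq> 0} \<le> s}"

definition delta_sparse :: "nat \<Rightarrow> real^'n \<Rightarrow> ereal" where
  "delta_sparse s w = (if w \<in> sparse_set s then 0 else \<infinity>)"

definition heaviside :: "real \<Rightarrow> real" where
  "heaviside t = (if t > 0 then 1 else 0)"

definition J :: "real^'m \<Rightarrow> real" where
  "J \<xi> = (\<Sum>i\<in>UNIV. heaviside (\<xi> $ i))"

definition Proj_sparse :: "nat \<Rightarrow> real^'n \<Rightarrow> (real^'n) set" where
  "Proj_sparse s w = {p. is_arg_min (\<lambda>q. norm (q - w)) (\<lambda>q. q \<in> sparse_set s) p}"

definition prox_objective :: "real \<Rightarrow> real \<Rightarrow> real^'m \<Rightarrow> real^'m \<Rightarrow> real" where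
  "prox_objective \<beta> lam \<xi> q = lam * J q + 1 / (2 * \<beta>) * (norm (q - \<xi>))\<^sup>2"

definition Prox_J :: "real \<Rightarrow> real \<Rightarrow> real^'m \<Rightarrow> (real^'m) set" where
  "Prox_J \<beta> lam \<xi> = {q. is_arg_min (prox_objective \<beta> lam \<xi>) (\<lambda>_. True) q}"

text \<open>
  The value of the proximal problem, written as an infimum; for \<open>\<beta>, lam > 0\<close> it is attained.
\<close>
definition Phi_J :: "real \<Rightarrow> real \<Rightarrow> real^'m \<Rightarrow> real" where
  "Phi_J \<beta> lam \<xi> = (INF q. prox_objective \<beta> lam \<xi> q)"

definition largest_sets :: "nat \<Rightarrow> real^'n \<Rightarrow> 'n set set" where
  "largest_sets s w = {T. card T = s \<and> (\<forall>i\<in>T. \<forall>j\<in>-T. \<bar>w $ j\<bar> \<le> \<bar>w $ i\<bar>)}"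

definition P_stationary ::
  "real^'n^'m \<Rightarrow> nat \<Rightarrow> real \<Rightarrow> (real^'n) \<times> (real^'m) \<Rightarrow> real^'m \<Rightarrow> bool" where
  "P_stationary A s lam u z \<longleftrightarrow> (case u of (w, \<xi>) \<Rightarrow>
     \<exists>\<alpha>>0. \<exists>\<beta>>0.
       w \<in> Proj_sparse s (w - \<alpha> *\<^sub>R (w + transpose A *v z)) \<and>
       \<xi> \<in> Prox_J \<beta> lam (\<xi> + \<beta> *\<^sub>R z) \<and>
       A *v w + vec 1 - \<xi> = 0)"

definition objective :: "nat \<Rightarrow> real \<Rightarrow> (real^'n) \<times> (real^'m) \<Rightarrow> ereal" where
  "objective s lam u = (case u of (w, \<xi>) \<Rightarrow>
     ereal (1/2 * (norm w)\<^sup>2 + lam * J \<xi>) + delta_sparse s w)"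

definition feasible :: "real^'n^'m \<Rightarrow> (real^'n) \<times> (real^'m) \<Rightarrow> bool" where
  "feasible A u \<longleftrightarrow> (case u of (w, \<xi>) \<Rightarrow> A *v w + vec 1 = \<xi>)"

definition strict_local_minimizer ::
  "real^'n^'m \<Rightarrow> nat \<Rightarrow> real \<Rightarrow> (real^'n) \<times> (real^'m) \<Rightarrow> bool" where
  "strict_local_minimizer A s lam u \<longleftrightarrow>
     feasible A u \<and> objective s lam u < \<infinity> \<and>
     (\<exists>e>0. \<forall>u'. feasible A u' \<and> u' \<noteq> u \<and> dist u' u < e \<longrightarrow> objective s lam u < objective s lam u')"

definition g ::
  "real^'n^'m \<Rightarrow> real \<Rightarrow> real \<Rightarrow> (real^'n) \<times> (real^'m) \<Rightarrow> real^'m \<Rightarrow> real^'n \<Rightarrow> real" where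
  "g A \<rho> \<mu> u z v = (case u of (w, \<xi>) \<Rightarrow>
     1/2 * (norm w)\<^sup>2 + z \<bullet> (A *v w + vec 1 - \<xi>)
       + \<rho>/2 * (norm (A *v w + vec 1 - \<xi>))\<^sup>2 + \<mu>/2 * (norm (w - v))\<^sup>2)"

definition merit ::
  "real^'n^'m \<Rightarrow> nat \<Rightarrow> real \<Rightarrow> real \<Rightarrow> real \<Rightarrow> (real^'n) \<times> (real^'m) \<Rightarrow> real^'m \<Rightarrow> real^'n \<Rightarrow> ereal"
  where
  "merit A s lam \<rho> \<mu> u z v =
     ereal (g A \<rho> \<mu> u z v) + delta_sparse s (fst u) + ereal (lam * J (snd u))"

definition gradient :: "('a::real_inner \<Rightarrow> real) \<Rightarrow> 'a \<Rightarrow> 'a" where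
  "gradient f x = (THE D. GDERIV f x :> D)"

definition grad_w ::
  "real^'n^'m \<Rightarrow> real \<Rightarrow> real \<Rightarrow> real^'m \<Rightarrow> real^'n \<Rightarrow> (real^'n) \<times> (real^'m) \<Rightarrow> real^'n" where
  "grad_w A \<rho> \<mu> z v u = gradient (\<lambda>w. g A \<rho> \<mu> (w, snd u) z v) (fst u)"

definition grad_xi ::
  "real^'n^'m \<Rightarrow> real \<Rightarrow> real \<Rightarrow> real^'m \<Rightarrow> real^'n \<Rightarrow> (real^'n) \<times> (real^'m) \<Rightarrow> real^'m" where
  "grad_xi A \<rho> \<mu> z v u = gradient (\<lambda>\<xi>. g A \<rho> \<mu> (fst u, \<xi>) z v) (snd u)"

text \<open>
  The stacked vectors \<open>[p\<^bsub>T\<^esub>; q\<^bsub>-T\<^esub>]\<close> in the first two residuals are represented up to a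
  permutation of their entries, which does not affect the norm.
\<close>
definition mix :: "'n set \<Rightarrow> real^'n \<Rightarrow> real^'n \<Rightarrow> real^'n" where
  "mix T p q = (\<chi> i. if i \<in> T then p $ i else q $ i)"

definition R1 ::
  "real^'n^'m \<Rightarrow> real \<Rightarrow> real \<Rightarrow> real^'m \<Rightarrow> real^'n \<Rightarrow> 'n set \<Rightarrow> (real^'n) \<times> (real^'m) \<Rightarrow> real" where
  "R1 A \<rho> \<mu> z v T u = norm (mix T (grad_w A \<rho> \<mu> z v u) (fst u))"

definition Gamma_set ::
  "real^'n^'m \<Rightarrow> real \<Rightarrow> real \<Rightarrow> real \<Rightarrow> real \<Rightarrow> real^'m \<Rightarrow> real^'n \<Rightarrow>
   (real^'n) \<times> (real^'m) \<Rightarrow> 'm set" where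
  "Gamma_set A lam \<rho> \<mu> \<beta> z v u =
     {i. (snd u - \<beta> *\<^sub>R grad_xi A \<rho> \<mu> z v u) $ i \<in> {..0} \<union> {sqrt (2 * \<beta> * lam)..}}"

definition R2 ::
  "real^'n^'m \<Rightarrow> real \<Rightarrow> real \<Rightarrow> real \<Rightarrow> real \<Rightarrow> real^'m \<Rightarrow> real^'n \<Rightarrow>
   (real^'n) \<times> (real^'m) \<Rightarrow> real" where
  "R2 A lam \<rho> \<mu> \<beta> z v u =
     norm (mix (Gamma_set A lam \<rho> \<mu> \<beta> z v u) (grad_xi A \<rho> \<mu> z v u) (snd u))"

definition R3 ::
  "real^'n^'m \<Rightarrow> real \<Rightarrow> real \<Rightarrow> real \<Rightarrow> real \<Rightarrow> real^'m \<Rightarrow> real^'n \<Rightarrow>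
   (real^'n) \<times> (real^'m) \<Rightarrow> real" where
  "R3 A lam \<rho> \<mu> \<beta> z v u =
     \<beta>/2 * (norm (grad_xi A \<rho> \<mu> z v u))\<^sup>2 + lam * J (snd u)
       - Phi_J \<beta> lam (snd u - \<beta> *\<^sub>R grad_xi A \<rho> \<mu> z v u)"

text \<open>
  One iteration, from \<open>(u, z)\<close> to \<open>(u', z')\<close> with tolerance \<open>\<theta>\<close>. The set \<open>T\<close> may be any member
  of \<open>largest_sets\<close>, since ties can be broken arbitrarily.
\<close>
definition iPAL_step ::
  "real^'n^'m \<Rightarrow> nat \<Rightarrow> real \<Rightarrow> real \<Rightarrow> real \<Rightarrow> real \<Rightarrow> real \<Rightarrow> real \<Rightarrow> real \<Rightarrow> real \<Rightarrow>
   (real^'n) \<times> (real^'m) \<Rightarrow> real^'m \<Rightarrow> (real^'n) \<times> (real^'m) \<Rightarrow> real^'m \<Rightarrow> bool" where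
  "iPAL_step A s lam \<rho> \<mu> \<alpha> \<beta> c\<^sub>1 c\<^sub>2 \<theta> u z u' z' \<longleftrightarrow>
     merit A s lam \<rho> \<mu> u' z (fst u) \<le> merit A s lam \<rho> \<mu> u z (fst u) \<and>
     fst u' \<in> sparse_set s \<and>
     (\<exists>T \<in> largest_sets s (fst u' - \<alpha> *\<^sub>R grad_w A \<rho> \<mu> z (fst u) u').
        R1 A \<rho> \<mu> z (fst u) T u' \<le> c\<^sub>1 * norm (fst u' - fst u)) \<and>
     R2 A lam \<rho> \<mu> \<beta> z (fst u) u' \<le> c\<^sub>2 * (norm (fst u' - fst u))\<^sup>2 \<and>
     R3 A lam \<rho> \<mu> \<beta> z (fst u) u' \<le> \<theta> \<and>
     z' = z + \<rho> *\<^sub>R (A *v fst u' + vec 1 - snd u')"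

definition iPAL_sequence ::
  "real^'n^'m \<Rightarrow> nat \<Rightarrow> real \<Rightarrow> real \<Rightarrow> real \<Rightarrow> real \<Rightarrow> real \<Rightarrow> real \<Rightarrow> real \<Rightarrow> (nat \<Rightarrow> real) \<Rightarrow>
   (nat \<Rightarrow> (real^'n) \<times> (real^'m)) \<Rightarrow> (nat \<Rightarrow> real^'m) \<Rightarrow> bool" where
  "iPAL_sequence A s lam \<rho> \<mu> \<alpha> \<beta> c\<^sub>1 c\<^sub>2 \<theta> u z \<longleftrightarrow>
     (\<forall>k. iPAL_step A s lam \<rho> \<mu> \<alpha> \<beta> c\<^sub>1 c\<^sub>2 (\<theta> k) (u k) (z k) (u (Suc k)) (z (Suc k)))"

end

theory Submission
  imports Defs
begin

text \<open>
  Write \<open>\<Delta>\<^sub>k\<close> for the step from \<open>w\<^sub>k\<close> to \<open>w\<^sub>k\<^sub>+\<^sub>1\<close>, and \<open>L\<close> for the augmented Lagrangian. The proof has two parts: a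
  Lyapunov argument that makes all steps vanish, and a rigidity argument that turns vanishing steps
  into convergence.

  \<^bold>\<open>Vanishing steps.\<close> The definition of \<open>\<gamma>\<close> says that \<open>\<gamma> \<parallel>z\<parallel> \<le> \<parallel>A\<^sub>T\<^sup>\<top> z\<parallel>\<close> whenever \<open>T\<close> has at least
  \<open>s div 2\<close> elements (\<open>restricted_row_bound\<close>). Hence multipliers are controlled by primal
  quantities. The index sets of two consecutive steps either share \<open>s div 2\<close> elements or each has
  that many outside the other, and in both cases the first residual yields
  \<open>\<parallel>z\<^sub>k\<^sub>+\<^sub>2 - z\<^sub>k\<^sub>+\<^sub>1\<parallel> \<le> c\<^sub>3 \<parallel>\<Delta>\<^sub>k\<^sub>+\<^sub>1\<parallel> + c\<^sub>4 \<parallel>\<Delta>\<^sub>k\<parallel>\<close> (\<open>dual_step_le\<close>). The primal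
  step lowers \<open>L\<close> by at least \<open>\<mu>/2 \<parallel>\<Delta>\<^sub>k\<^sub>+\<^sub>1\<parallel>\<^sup>2\<close>, and the dual step raises it by
  \<open>\<parallel>z\<^sub>k\<^sub>+\<^sub>2 - z\<^sub>k\<^sub>+\<^sub>1\<parallel>\<^sup>2 / \<rho>\<close>. For large \<open>\<rho>\<close> the sum of \<open>L\<close> and a multiple of \<open>\<parallel>\<Delta>\<^sub>k\<parallel>\<^sup>2\<close>
  therefore decreases (\<open>lyapunov_decrease\<close>); it also dominates \<open>\<parallel>w\<parallel>\<^sup>2 / 8\<close> (\<open>lyapunov_ge\<close>). So the
  iterates are bounded, and the primal steps, the dual steps and the constraint violation tend to 0.

  \<^bold>\<open>Convergence.\<close> By the residual conditions every cluster point of the primal-dual sequence is a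
  P-stationary pair (\<open>cluster_point_P_stationary\<close>). There are only finitely many such pairs
  (\<open>finite_first_order\<close>): once the support of \<open>w\<close> and the zeros of \<open>z\<close> are fixed, the conditions are
  linear and the row bound makes their solution unique. A bounded sequence with vanishing steps and
  finitely many cluster points converges (\<open>convergent_if_finite_cluster_points\<close>). Strict local
  minimality of the limit holds because near it no positive entry of \<open>\<xi>\<close> can be lost and gaining one
  costs \<open>lam\<close>, whereas among points with the same positive entries \<open>z\<close> is a Lagrange multiplier for a
  strictly convex objective (\<open>first_order_strict_local_minimizer\<close>).
\<close>

section \<open>The smallest eigenvalue of a Gram matrix and restricted row bounds\<close>

(* Keeps A\<^sup>\<top> z in the form transpose A *v z. *)
declare transpose_matrix_vector [simp del]

lemma inner_matrix_vector: "x \<bullet> (A *v y) = (transpose A *v x) \<bullet> y"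
  for A :: "real^'n^'m"
  by (simp add: dot_lmul_matrix transpose_matrix_vector)

text \<open>
  Eigenvectors of a symmetric matrix to distinct eigenvalues are orthogonal, hence independent. This
  makes the minimum in \<^const>\<open>lambda_min\<close> one over a finite set.
\<close>
lemma finite_eigenvalues_symmetric:
  fixes B :: "real^'n^'n"
  assumes "transpose B = B"
  shows "finite (eigenvalues B)"
proof -
  define V where "V e = (SOME v. v \<noteq> 0 \<and> B *v v = e *\<^sub>R v)" for e
  have V: "V e \<noteq> 0" "B *v V e = e *\<^sub>R V e" if "e \<in> eigenvalues B" for e
    using someI_ex[of "\<lambda>v. v \<noteq> 0 \<and> B *v v = e *\<^sub>R v"] that
    unfolding V_def eigenvalues_def by auto
  have orth: "V e \<bullet> V f = 0" if e: "e \<in> eigenvalues B" and f: "f \<in> eigenvalues B" and "e \<noteq> f" for e f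
  proof -
    have "f * (V e \<bullet> V f) = V e \<bullet> (B *v V f)"
      using V[OF f] by simp
    also have "\<dots> = (B *v V e) \<bullet> V f"
      by (simp add: inner_matrix_vector assms)
    also have "\<dots> = e * (V e \<bullet> V f)"
      using V[OF e] by simp
    finally show ?thesis
      using \<open>e \<noteq> f\<close> by simp
  qed
  have "inj_on V (eigenvalues B)"
  proof (rule inj_onI, rule ccontr)
    fix e f
    assume "e \<in> eigenvalues B" "f \<in> eigenvalues B" "V e = V f" "e \<noteq> f"
    then show False
      using orth[of e f] V(1)[of f] by simp
  qed
  moreover have "finite (V ` eigenvalues B)"
  proof (rule conjunct1[OF independent_bound], rule pairwise_orthogonal_independent)
    show "pairwise orthogonal (V ` eigenvalues B)"
      using orth by (auto simp: pairwise_def orthogonal_def)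
    show "0 \<notin> V ` eigenvalues B"
      using V by auto
  qed
  ultimately show ?thesis
    using finite_imageD by blast
qed

text \<open>
  The Rayleigh quotient attains its minimum on the unit sphere; the first-order condition at a
  minimizer says that the minimal value is an eigenvalue, so the least eigenvalue bounds the
  quotient from below.
\<close>
lemma lambda_min_le_rayleigh:
  fixes B :: "real^'n^'n"
  assumes sym: "transpose B = B"
  shows "lambda_min B * (norm v)\<^sup>2 \<le> v \<bullet> (B *v v)"
proof -
  have cont: "continuous_on (sphere 0 1) (\<lambda>v. v \<bullet> (B *v v))"
    by (intro continuous_intros linear_continuous_on matrix_vector_mul_bounded_linear)
  have "axis undefined 1 \<in> sphere (0 :: real^'n) 1"
    by simp
  then have "sphere (0 :: real^'n) 1 \<noteq> {}"
    by blast
  then obtain p where p: "norm p = 1" "\<And>v. norm v = 1 \<Longrightarrow> p \<bullet> (B *v p) \<le> v \<bullet> (B *v v)"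
    using continuous_attains_inf[OF compact_sphere _ cont] by auto
  define e where "e = p \<bullet> (B *v p)"
  have quot: "e * (v \<bullet> v) \<le> v \<bullet> (B *v v)" for v
  proof (cases "v = 0")
    case False
    have "e \<le> (v /\<^sub>R norm v) \<bullet> (B *v (v /\<^sub>R norm v))"
      unfolding e_def using False by (intro p(2)) simp
    also have "\<dots> = (v \<bullet> (B *v v)) / (v \<bullet> v)"
      by (simp add: matrix_vector_mult_scaleR dot_square_norm power2_eq_square divide_simps)
    finally show ?thesis
      using False by (simp add: pos_le_divide_eq)
  qed simp
  have "(B *v p - e *\<^sub>R p) \<bullet> (B *v p - e *\<^sub>R p) = 0"
  proof (rule ccontr)
    define h where "h = B *v p - e *\<^sub>R p"
    assume "h \<bullet> h \<noteq> 0"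
    then have hpos: "0 < h \<bullet> h"
      by simp
    \<comment> \<open>Moving from \<open>p\<close> to \<open>p - t h\<close> changes the quadratic form of \<open>B - e I\<close>, which is nonnegative
      and vanishes at \<open>p\<close>, by \<open>- 2 t (h \<bullet> h) + t\<^sup>2 C\<close>; this is negative for small \<open>t\<close>.\<close>
    define C where "C = h \<bullet> (B *v h) - e * (h \<bullet> h)"
    define t where "t = (h \<bullet> h) / (\<bar>C\<bar> + 1)"
    have t: "t > 0" "t * C \<le> h \<bullet> h"
    proof -
      show "t > 0"
        using hpos by (simp add: t_def)
      then have "t * C \<le> t * (\<bar>C\<bar> + 1)"
        by (intro mult_left_mono) auto
      then show "t * C \<le> h \<bullet> h"
        by (simp add: t_def)
    qed
    have "h \<bullet> (B *v p) = p \<bullet> (B *v h)"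
      unfolding inner_matrix_vector[of p] sym by (rule inner_commute)
    moreover have "h \<bullet> (B *v p) = h \<bullet> h + e * (h \<bullet> p)"
      by (simp add: h_def algebra_simps)
    moreover have "e * ((p - t *\<^sub>R h) \<bullet> (p - t *\<^sub>R h)) \<le> (p - t *\<^sub>R h) \<bullet> (B *v (p - t *\<^sub>R h))"
      by (rule quot)
    moreover have "p \<bullet> p = 1"
      using p(1) by (simp add: dot_square_norm)
    moreover have "h \<bullet> p = p \<bullet> h"
      by (rule inner_commute)
    ultimately have "e - 2 * t * (e * (p \<bullet> h)) + t\<^sup>2 * (e * (h \<bullet> h))
        \<le> e - 2 * t * (h \<bullet> h + e * (p \<bullet> h)) + t\<^sup>2 * (h \<bullet> (B *v h))"
      by (simp add: algebra_simps matrix_vector_mult_scaleR e_def[symmetric] power2_eq_square)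
    then have "0 \<le> - 2 * t * (h \<bullet> h) + t * (t * C)"
      by (simp add: C_def algebra_simps power2_eq_square)
    also have "\<dots> \<le> - 2 * t * (h \<bullet> h) + t * (h \<bullet> h)"
      using t by simp
    also have "\<dots> < 0"
      using t(1) hpos by simp
    finally show False
      by simp
  qed
  then have "B *v p = e *\<^sub>R p"
    by simp
  moreover have "p \<noteq> 0"
    using p(1) by auto
  ultimately have "e \<in> eigenvalues B"
    unfolding eigenvalues_def by blast
  then have "lambda_min B \<le> e"
    unfolding lambda_min_def by (intro Min_le finite_eigenvalues_symmetric sym)
  then have "lambda_min B * (norm v)\<^sup>2 \<le> e * (norm v)\<^sup>2"
    by (intro mult_right_mono) auto
  also have "\<dots> \<le> v \<bullet> (B *v v)"
    using quot[of v] by (simp add: dot_square_norm)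
  finally show ?thesis .
qed

lemma norm_mix_le:
  assumes "T \<subseteq> T'"
  shows "norm (mix T p 0) \<le> norm (mix T' p q)"
  using assms by (intro norm_le_componentwise_cart) (auto simp: mix_def)

lemma norm_mix_compl_le:
  assumes "T \<inter> T' = {}"
  shows "norm (mix T q 0) \<le> norm (mix T' p q)"
  using assms by (intro norm_le_componentwise_cart) (auto simp: mix_def)

lemma norm_mix_le_norm: "norm (mix T p 0) \<le> norm p"
  by (intro norm_le_componentwise_cart) (auto simp: mix_def)

lemma transpose_col_submatrix:
  "transpose (col_submatrix A T) *v z = mix T (transpose A *v z) 0"
  by (auto simp: vec_eq_iff mix_def col_submatrix_def transpose_def matrix_vector_mult_def)

text \<open>
  Enlarging \<open>T\<close> only adds coordinates to \<open>A\<^sub>T\<^sup>\<top> z\<close>, so the bound for the sets of one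
  cardinality carries over to all larger sets.
\<close>
lemma restricted_row_bound:
  fixes A :: "real^'n^'m"
  assumes "\<gamma> > 0"
    and \<gamma>: "\<gamma>\<^sup>2 = Min ((\<lambda>T. lambda_min (col_submatrix A T ** transpose (col_submatrix A T)))
                   ` {T :: 'n set. card T = r})"
    and "r \<le> card T"
  shows "\<gamma> * norm z \<le> norm (mix T (transpose A *v z) 0)"
proof -
  obtain T' where T': "T' \<subseteq> T" "card T' = r"
    using obtain_subset_with_card_n[OF \<open>r \<le> card T\<close>] by auto
  let ?C = "col_submatrix A T'"
  have "\<gamma>\<^sup>2 \<le> lambda_min (?C ** transpose ?C)"
    unfolding \<gamma> using T' by (intro Min_le) auto
  then have "\<gamma>\<^sup>2 * (norm z)\<^sup>2 \<le> lambda_min (?C ** transpose ?C) * (norm z)\<^sup>2"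
    by (intro mult_right_mono) auto
  also have "\<dots> \<le> z \<bullet> ((?C ** transpose ?C) *v z)"
    by (rule lambda_min_le_rayleigh) (simp add: matrix_transpose_mul)
  also have "\<dots> = (norm (transpose ?C *v z))\<^sup>2"
    by (simp add: matrix_vector_mul_assoc[symmetric] inner_matrix_vector dot_square_norm)
  finally have "(\<gamma> * norm z)\<^sup>2 \<le> (norm (mix T' (transpose A *v z) 0))\<^sup>2"
    by (simp add: power_mult_distrib transpose_col_submatrix)
  then have "\<gamma> * norm z \<le> norm (mix T' (transpose A *v z) 0)"
    by (rule power2_le_imp_le) simp
  also have "\<dots> \<le> norm (mix T (transpose A *v z) 0)"
    by (rule norm_mix_le) fact
  finally show ?thesis .
qed

section \<open>First-order conditions at P-stationary pairs\<close>

text \<open>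
  The part of P-stationarity that does not mention the step sizes \<open>\<alpha>\<close>, \<open>\<beta>\<close>. It consists of
  finitely many linear systems selected by sign patterns, and it suffices both for strict local
  minimality and for finiteness.
\<close>
definition first_order ::
  "real^'n^'m \<Rightarrow> nat \<Rightarrow> (real^'n) \<times> (real^'m) \<Rightarrow> real^'m \<Rightarrow> bool" where
  "first_order A s u z \<longleftrightarrow> (case u of (w, \<xi>) \<Rightarrow>
     w \<in> sparse_set s \<and>
     (\<forall>i. w $ i \<noteq> 0 \<or> card {j. w $ j \<noteq> 0} < s \<longrightarrow> (w + transpose A *v z) $ i = 0) \<and>
     (\<forall>i. z $ i = 0 \<or> \<xi> $ i = 0 \<and> 0 \<le> z $ i) \<and>
     A *v w + vec 1 = \<xi>)"

lemma nonneg_if_quadratic_nonneg_near_0: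
  fixes a c :: real
  assumes "d > 0" and "\<And>t. 0 < t \<Longrightarrow> t < d \<Longrightarrow> 0 \<le> a * t\<^sup>2 + t * c"
  shows "0 \<le> c"
proof (rule tendsto_lowerbound)
  show "((\<lambda>t. a * t + c) \<longlongrightarrow> c) (at_right 0)"
    by (auto intro!: tendsto_eq_intros)
  have "0 \<le> a * t + c" if "0 < t" "t < d" for t
  proof -
    have "0 \<le> t * (a * t + c)"
      using assms(2)[OF that] by (simp add: power2_eq_square algebra_simps)
    then show ?thesis
      using that(1) by (simp add: zero_le_mult_iff)
  qed
  then show "\<forall>\<^sub>F t in at_right 0. 0 \<le> a * t + c"
    unfolding eventually_at_right_field using \<open>d > 0\<close> by blast
qed simp

lemma norm_axis_add_sq:
  "(norm (t *\<^sub>R axis i 1 + p))\<^sup>2 = t\<^sup>2 + 2 * t * (p $ i) + (norm p)\<^sup>2"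
  for p :: "real^'n"
  unfolding power2_norm_eq_inner
  by (simp add: inner_add_left inner_add_right inner_axis inner_axis' power2_eq_square
      algebra_simps)

text \<open>
  If \<open>i\<close> belongs to the support of \<open>w\<close>, or the support can still be enlarged, then \<open>w\<close> may be moved
  freely along the \<open>i\<close>-th axis without leaving the sparse vectors.
\<close>
lemma Proj_sparse_first_order:
  assumes proj: "w \<in> Proj_sparse s (w - \<alpha> *\<^sub>R d)" and "\<alpha> > 0"
    and i: "w $ i \<noteq> 0 \<or> card {j. w $ j \<noteq> 0} < s"
  shows "d $ i = 0"
proof -
  have sparse: "w + t *\<^sub>R axis i 1 \<in> sparse_set s" for t
  proof -
    have "{j. (w + t *\<^sub>R axis i 1) $ j \<noteq> 0} \<subseteq> insert i {j. w $ j \<noteq> 0}"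
      by (auto simp: axis_def)
    then have "card {j. (w + t *\<^sub>R axis i 1) $ j \<noteq> 0} \<le> card (insert i {j. w $ j \<noteq> 0})"
      by (intro card_mono) auto
    also have "\<dots> \<le> s"
      using i proj
      by (auto simp: Proj_sparse_def is_arg_min_def sparse_set_def card_insert_if insert_absorb)
    finally show ?thesis
      by (simp add: sparse_set_def)
  qed
  have ineq: "0 \<le> t\<^sup>2 + t * (2 * \<alpha> * d $ i)" for t
  proof -
    have "norm (w - (w - \<alpha> *\<^sub>R d)) \<le> norm (w + t *\<^sub>R axis i 1 - (w - \<alpha> *\<^sub>R d))"
      using proj sparse[of t] by (auto simp: Proj_sparse_def is_arg_min_def not_less)
    then have "(norm (\<alpha> *\<^sub>R d))\<^sup>2 \<le> (norm (t *\<^sub>R axis i 1 + \<alpha> *\<^sub>R d))\<^sup>2"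
      by (intro power_mono) (simp_all add: algebra_simps)
    then show ?thesis
      unfolding norm_axis_add_sq by simp
  qed
  have "0 \<le> 2 * \<alpha> * d $ i"
    by (rule nonneg_if_quadratic_nonneg_near_0[of 1 1]) (use ineq in auto)
  moreover have "0 \<le> - (2 * \<alpha> * d $ i)"
    by (rule nonneg_if_quadratic_nonneg_near_0[of 1 1]) (use ineq[of "- t" for t] in auto)
  ultimately show ?thesis
    using \<open>\<alpha> > 0\<close> by (simp add: mult_le_0_iff zero_le_mult_iff)
qed

lemma J_add_axis_le:
  assumes "0 < \<xi> $ i \<or> \<xi> $ i + t \<le> 0"
  shows "J (\<xi> + t *\<^sub>R axis i 1) \<le> J \<xi>"
  unfolding J_def using assms
  by (intro sum_mono) (auto simp: heaviside_def axis_def)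

text \<open>
  Moving a positive entry of \<open>\<xi>\<close> anywhere, or any entry into \<open>(-\<infinity>, 0]\<close>, does not increase \<open>J\<close>. Along
  such moves the quadratic part of the proximal objective alone must not decrease.
\<close>
lemma Prox_J_first_order:
  assumes prox: "\<xi> \<in> Prox_J \<beta> lam (\<xi> + \<beta> *\<^sub>R z)" and "\<beta> > 0" "lam > 0"
  shows "z $ i = 0 \<or> \<xi> $ i = 0 \<and> 0 \<le> z $ i"
proof -
  have ineq: "0 \<le> t\<^sup>2 - t * (2 * \<beta> * z $ i)" if t: "0 < \<xi> $ i \<or> \<xi> $ i + t \<le> 0" for t
  proof -
    have "prox_objective \<beta> lam (\<xi> + \<beta> *\<^sub>R z) \<xi>
        \<le> prox_objective \<beta> lam (\<xi> + \<beta> *\<^sub>R z) (\<xi> + t *\<^sub>R axis i 1)"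
      using prox by (auto simp: Prox_J_def is_arg_min_def not_less)
    moreover have "lam * J (\<xi> + t *\<^sub>R axis i 1) \<le> lam * J \<xi>"
      using J_add_axis_le[OF t] \<open>lam > 0\<close> by simp
    ultimately have "1 / (2 * \<beta>) * (norm (\<beta> *\<^sub>R z))\<^sup>2
        \<le> 1 / (2 * \<beta>) * (norm (t *\<^sub>R axis i 1 + (- (\<beta> *\<^sub>R z))))\<^sup>2"
      by (simp add: prox_objective_def algebra_simps)
    then have "(norm (\<beta> *\<^sub>R z))\<^sup>2 \<le> (norm (t *\<^sub>R axis i 1 + (- (\<beta> *\<^sub>R z))))\<^sup>2"
      using \<open>\<beta> > 0\<close> by (simp add: divide_right_mono field_simps)
    then show ?thesis
      unfolding norm_axis_add_sq by simp
  qed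
  have nonneg: "0 \<le> z $ i"
  proof -
    have "0 \<le> 2 * \<beta> * z $ i"
      by (rule nonneg_if_quadratic_nonneg_near_0[of 1 1]; cases "0 < \<xi> $ i";
          use ineq[of "- t" for t] in auto)
    then show ?thesis
      using \<open>\<beta> > 0\<close> by (simp add: zero_le_mult_iff)
  qed
  have nonpos: "z $ i \<le> 0" if "\<xi> $ i < 0 \<or> 0 < \<xi> $ i"
  proof -
    have "0 \<le> - (2 * \<beta> * z $ i)"
      by (rule nonneg_if_quadratic_nonneg_near_0[of "\<bar>\<xi> $ i\<bar>" 1]) (use ineq that in auto)
    then show ?thesis
      using \<open>\<beta> > 0\<close> by (simp add: mult_le_0_iff)
  qed
  show ?thesis
    using nonneg nonpos by (cases "\<xi> $ i" "0 :: real" rule: linorder_cases) (auto intro: antisym)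
qed

lemma P_stationary_first_order:
  assumes "P_stationary A s lam u z" "lam > 0"
  shows "first_order A s u z"
proof -
  obtain w \<xi> where u: "u = (w, \<xi>)"
    by fastforce
  obtain \<alpha> \<beta> where "\<alpha> > 0" "\<beta> > 0"
    and proj: "w \<in> Proj_sparse s (w - \<alpha> *\<^sub>R (w + transpose A *v z))"
    and prox: "\<xi> \<in> Prox_J \<beta> lam (\<xi> + \<beta> *\<^sub>R z)"
    and feas: "A *v w + vec 1 - \<xi> = 0"
    using assms(1) unfolding P_stationary_def u by auto
  have "w \<in> sparse_set s"
    using proj by (simp add: Proj_sparse_def is_arg_min_def)
  moreover have "A *v w + vec 1 = \<xi>"
    using feas by simp
  ultimately show ?thesis
    unfolding first_order_def u
    using Proj_sparse_first_order[OF proj \<open>\<alpha> > 0\<close>] Prox_J_first_order[OF prox \<open>\<beta> > 0\<close> \<open>lam > 0\<close>]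
    by auto
qed

text \<open>
  Near \<open>(w, \<xi>)\<close> no positive entry of \<open>\<xi>\<close> and no nonzero entry of \<open>w\<close> is lost. If a positive
  entry is gained, the loss function grows by \<open>lam\<close>, which outweighs the change of the smooth
  part. Otherwise \<open>z\<close> serves as a Lagrange multiplier: for a sparse
  competitor \<open>w'\<close>, both \<open>\<langle>w + A\<^sup>\<top> z, w' - w\<rangle> = 0\<close> and
  \<open>\<langle>z, \<xi>' - \<xi>\<rangle> \<le> 0\<close>, so that \<open>\<langle>w, w' - w\<rangle> \<ge> 0\<close> and the strictly convex term decides.
\<close>
lemma first_order_strict_local_minimizer:
  fixes A :: "real^'n^'m"
  assumes fo: "first_order A s u z" and "lam > 0"
  shows "strict_local_minimizer A s lam u"
proof -
  obtain w \<xi> where u: "u = (w, \<xi>)"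
    by fastforce
  have sp: "w \<in> sparse_set s"
    and d: "\<And>i. w $ i \<noteq> 0 \<or> card {j. w $ j \<noteq> 0} < s \<Longrightarrow> (w + transpose A *v z) $ i = 0"
    and z: "\<And>i. z $ i = 0 \<or> \<xi> $ i = 0 \<and> 0 \<le> z $ i"
    and feas: "A *v w + vec 1 = \<xi>"
    using fo unfolding first_order_def u by auto
  have "((\<lambda>u'. u') \<longlongrightarrow> (w, \<xi>)) (nhds u)"
    by (simp add: u filterlim_ident)
  then have lim: "((\<lambda>u'. fst u') \<longlongrightarrow> w) (nhds u)" "((\<lambda>u'. snd u') \<longlongrightarrow> \<xi>) (nhds u)"
    by (auto dest: tendsto_fst tendsto_snd)
  have "\<forall>\<^sub>F u' in nhds u. (\<forall>i. w $ i \<noteq> 0 \<longrightarrow> fst u' $ i \<noteq> 0) \<and> (\<forall>i. 0 < \<xi> $ i \<longrightarrow> 0 < snd u' $ i)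
      \<and> 1/2 * (norm w)\<^sup>2 < 1/2 * (norm (fst u'))\<^sup>2 + lam"
  proof (intro eventually_conj eventually_all_finite)
    show "\<forall>\<^sub>F u' in nhds u. w $ i \<noteq> 0 \<longrightarrow> fst u' $ i \<noteq> 0" for i
      using tendsto_imp_eventually_ne[OF tendsto_vec_nth[OF lim(1)]]
      by (cases "w $ i = 0") auto
    show "\<forall>\<^sub>F u' in nhds u. 0 < \<xi> $ i \<longrightarrow> 0 < snd u' $ i" for i
      using order_tendstoD(1)[OF tendsto_vec_nth[OF lim(2)], of 0 i]
      by (cases "0 < \<xi> $ i") auto
    have "((\<lambda>u'. 1/2 * (norm (fst u'))\<^sup>2 + lam) \<longlongrightarrow> 1/2 * (norm w)\<^sup>2 + lam) (nhds u)"
      by (intro tendsto_intros lim)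
    then show "\<forall>\<^sub>F u' in nhds u. 1/2 * (norm w)\<^sup>2 < 1/2 * (norm (fst u'))\<^sup>2 + lam"
      by (rule order_tendstoD) (simp add: \<open>lam > 0\<close>)
  qed
  then obtain e where "e > 0" and near: "\<And>u'. dist u' u < e \<Longrightarrow>
      (\<forall>i. w $ i \<noteq> 0 \<longrightarrow> fst u' $ i \<noteq> 0) \<and> (\<forall>i. 0 < \<xi> $ i \<longrightarrow> 0 < snd u' $ i)
      \<and> 1/2 * (norm w)\<^sup>2 < 1/2 * (norm (fst u'))\<^sup>2 + lam"
    unfolding eventually_nhds_metric by blast
  have obj: "objective s lam u = ereal (1/2 * (norm w)\<^sup>2 + lam * J \<xi>)"
    using sp by (simp add: objective_def delta_sparse_def u)
  have "objective s lam u < objective s lam u'"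
    if feas': "feasible A u'" and "u' \<noteq> u" and "dist u' u < e" for u'
  proof -
    obtain w' \<xi>' where u': "u' = (w', \<xi>')"
      by fastforce
    have \<xi>': "\<xi>' = A *v w' + vec 1"
      using feas' by (simp add: feasible_def u')
    have supp: "w' $ i \<noteq> 0" if "w $ i \<noteq> 0" for i
      using near[OF \<open>dist u' u < e\<close>] that by (simp add: u')
    have pos: "0 < \<xi>' $ i" if "0 < \<xi> $ i" for i
      using near[OF \<open>dist u' u < e\<close>] that by (simp add: u')
    have J_mono: "heaviside (\<xi> $ i) \<le> heaviside (\<xi>' $ i)" for i
      using pos[of i] by (auto simp: heaviside_def)
    show ?thesis
    proof (cases "w' \<in> sparse_set s")
      case False
      then show ?thesis
        unfolding obj by (simp add: objective_def delta_sparse_def u')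
    next
      case sp': True
      have "1/2 * (norm w)\<^sup>2 + lam * J \<xi> < 1/2 * (norm w')\<^sup>2 + lam * J \<xi>'"
      proof (cases "\<exists>i. \<xi> $ i \<le> 0 \<and> 0 < \<xi>' $ i")
        case True
        then obtain i where i: "\<xi> $ i \<le> 0" "0 < \<xi>' $ i"
          by blast
        have "J \<xi> + 1 = (\<Sum>j\<in>UNIV. heaviside (\<xi> $ j) + (if j = i then 1 else 0))"
          by (simp add: J_def sum.distrib)
        also have "\<dots> \<le> J \<xi>'"
          unfolding J_def using pos i by (intro sum_mono) (auto simp: heaviside_def)
        finally have "lam * (J \<xi> + 1) \<le> lam * J \<xi>'"
          using \<open>lam > 0\<close> by (intro mult_left_mono) auto
        moreover have "1/2 * (norm w)\<^sup>2 < 1/2 * (norm w')\<^sup>2 + lam"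
          using near[OF \<open>dist u' u < e\<close>] by (simp add: u')
        ultimately show ?thesis
          by (simp add: algebra_simps)
      next
        case False
        have "J \<xi> \<le> J \<xi>'"
          unfolding J_def using J_mono by (intro sum_mono)
        then have J_le: "lam * J \<xi> \<le> lam * J \<xi>'"
          using \<open>lam > 0\<close> by simp
        have "(w + transpose A *v z) $ i * (w' - w) $ i = 0" for i
        proof (cases "w $ i \<noteq> 0 \<or> card {j. w $ j \<noteq> 0} < s")
          case False
          \<comment> \<open>The support of \<open>w\<close> is already as large as allowed, so \<open>w'\<close> has the same one.\<close>
          have "{j. w $ j \<noteq> 0} = {j. w' $ j \<noteq> 0}"
            using False sp' supp by (intro card_seteq) (auto simp: sparse_set_def)
          then have "w' $ i = 0"
            using False by auto
          then show ?thesis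
            using False by simp
        next
          case True
          show ?thesis
            using d[OF True] by simp
        qed
        then have "(w + transpose A *v z) \<bullet> (w' - w) = 0"
          by (simp only: inner_vec_def inner_real_def sum.neutral_const)
        moreover have "z \<bullet> (\<xi>' - \<xi>) \<le> 0"
          unfolding inner_vec_def
        proof (intro sum_nonpos)
          fix i
          show "z $ i \<bullet> (\<xi>' - \<xi>) $ i \<le> 0"
            using z[of i] False by (auto simp: not_less intro: mult_nonneg_nonpos)
        qed
        moreover have "z \<bullet> (\<xi>' - \<xi>) = (transpose A *v z) \<bullet> (w' - w)"
          by (simp add: \<xi>' feas[symmetric] matrix_vector_mult_diff_distrib[symmetric]
              inner_matrix_vector)
        ultimately have "0 \<le> w \<bullet> (w' - w)"
          by (simp add: inner_add_left)
        moreover have "w' \<noteq> w"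
          using \<open>u' \<noteq> u\<close> feas by (auto simp: u u' \<xi>')
        then have "0 < (w' - w) \<bullet> (w' - w)"
          by simp
        ultimately have "(norm w)\<^sup>2 < (norm w')\<^sup>2"
          by (simp add: power2_norm_eq_inner algebra_simps inner_commute)
        then show ?thesis
          using J_le by simp
      qed
      then show ?thesis
        unfolding obj using sp' by (simp add: objective_def delta_sparse_def u')
    qed
  qed
  moreover have "feasible A u"
    using feas by (simp add: feasible_def u)
  ultimately show ?thesis
    unfolding strict_local_minimizer_def using \<open>e > 0\<close> obj by auto
qed

text \<open>
  Every solution has index sets \<open>T\<close>, \<open>G\<close> such that \<open>w + A\<^sup>\<top> z\<close> vanishes on \<open>T\<close> and \<open>w\<close> off it, and \<open>z\<close>
  vanishes on \<open>G\<close> and \<open>\<xi>\<close> off it. The difference of two solutions with the same sets satisfies a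
  homogeneous system. Pairing \<open>z - z'\<close> with \<open>\<xi> - \<xi>'\<close> gives \<open>A\<^sub>T\<^sup>\<top> (z - z') = 0\<close>, and the row bound
  forces \<open>z = z'\<close>.
\<close>
lemma finite_first_order:
  fixes A :: "real^'n^'m"
  assumes "\<gamma> > 0" and s: "s \<le> CARD('n)"
    and row_bound: "\<And>T z. s div 2 \<le> card T \<Longrightarrow> \<gamma> * norm z \<le> norm (mix T (transpose A *v z) 0)"
  shows "finite {(u, z). first_order A s u z}"
proof -
  define S where "S T G = {((w, \<xi>), z). (\<forall>i\<in>T. (w + transpose A *v z) $ i = 0) \<and>
      (\<forall>i\<in>-T. w $ i = 0) \<and> (\<forall>i\<in>G. z $ i = 0) \<and> (\<forall>i\<in>-G. \<xi> $ i = 0) \<and> A *v w + vec 1 = \<xi>}"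
    for T :: "'n set" and G :: "'m set"
  have "{(u, z). first_order A s u z} \<subseteq> (\<Union>T\<in>{T. s div 2 \<le> card T}. \<Union>G\<in>UNIV. S T G)"
  proof (clarify)
    fix w \<xi> z
    assume fo: "first_order A s (w, \<xi>) z"
    define T where "T = (if card {j. w $ j \<noteq> 0} < s then UNIV else {j. w $ j \<noteq> 0})"
    have "s div 2 \<le> card T"
      using s by (auto simp: T_def)
    moreover have "((w, \<xi>), z) \<in> S T {i. z $ i = 0}"
      using fo unfolding first_order_def S_def T_def by auto
    ultimately show "((w, \<xi>), z) \<in> (\<Union>T\<in>{T. s div 2 \<le> card T}. \<Union>G\<in>UNIV. S T G)"
      by blast
  qed
  moreover have "finite (S T G)" if T: "s div 2 \<le> card T" for T G
  proof -
    have "p = p'" if "p \<in> S T G" "p' \<in> S T G" for p p'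
    proof -
      obtain w \<xi> z w' \<xi>' z' where p: "p = ((w, \<xi>), z)" and p': "p' = ((w', \<xi>'), z')"
        by (cases p, cases p') auto
      let ?dz = "z - z'" and ?dw = "w - w'"
      have dT: "?dw $ i = - (transpose A *v ?dz) $ i" if "i \<in> T" for i
      proof -
        have "(w + transpose A *v z) $ i = 0" "(w' + transpose A *v z') $ i = 0"
          using \<open>p \<in> S T G\<close> \<open>p' \<in> S T G\<close> that by (auto simp: S_def p p')
        then show ?thesis
          by (simp add: matrix_vector_mult_diff_distrib)
      qed
      have d0: "?dw $ i = 0" if "i \<notin> T" for i
        using \<open>p \<in> S T G\<close> \<open>p' \<in> S T G\<close> that by (auto simp: S_def p p')
      have dG: "?dz $ i * (\<xi> - \<xi>') $ i = 0" for i
        using \<open>p \<in> S T G\<close> \<open>p' \<in> S T G\<close> by (cases "i \<in> G") (auto simp: S_def p p')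
      have \<xi>: "\<xi> = A *v w + vec 1" "\<xi>' = A *v w' + vec 1"
        using \<open>p \<in> S T G\<close> \<open>p' \<in> S T G\<close> by (auto simp: S_def p p')
      have "0 = ?dz \<bullet> (\<xi> - \<xi>')"
        by (simp only: inner_vec_def inner_real_def dG sum.neutral_const)
      also have "\<dots> = (transpose A *v ?dz) \<bullet> ?dw"
        by (simp add: \<xi> matrix_vector_mult_diff_distrib[symmetric] inner_matrix_vector)
      also have "\<dots> = - (mix T (transpose A *v ?dz) 0 \<bullet> mix T (transpose A *v ?dz) 0)"
        unfolding inner_vec_def sum_negf[symmetric]
        by (intro sum.cong) (use dT d0 in \<open>auto simp: mix_def\<close>)
      finally have "norm (mix T (transpose A *v ?dz) 0) = 0"
        by simp
      then have "\<gamma> * norm ?dz \<le> 0"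
        using row_bound[OF T, of ?dz] by simp
      then have "z = z'"
        using \<open>\<gamma> > 0\<close> by (simp add: mult_le_0_iff)
      moreover have "w = w'"
      proof -
        have "?dw $ i = 0" for i
          using dT[of i] d0[of i] \<open>z = z'\<close> by (cases "i \<in> T") auto
        then show ?thesis
          by (simp add: vec_eq_iff)
      qed
      ultimately show ?thesis
        by (simp add: p p' \<xi>)
    qed
    then have "S T G = {} \<or> (\<exists>p. S T G = {p})"
      by blast
    then show ?thesis
      by auto
  qed
  then have "finite (\<Union>T\<in>{T. s div 2 \<le> card T}. \<Union>G\<in>UNIV. S T G)"
    by simp
  ultimately show ?thesis
    by (rule finite_subset)
qed

section \<open>Limits of approximate projections and proximal points\<close>

text \<open>
  The squared distance from \<open>a\<close> to its hard thresholding is the sum of the squares dropped. Another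
  sparse vector, with support \<open>Q\<close>, misses at least the entries of \<open>a\<close> off \<open>Q\<close>. The ones it misses in
  \<open>T - Q\<close> are at least as many, and each at least as large, as the ones it can keep in \<open>Q - T\<close>.
\<close>
lemma hard_threshold_in_Proj_sparse:
  fixes a p :: "real^'n"
  assumes T: "T \<in> largest_sets s a"
    and p: "\<And>i. i \<in> T \<Longrightarrow> p $ i = a $ i" "\<And>i. i \<notin> T \<Longrightarrow> p $ i = 0"
  shows "p \<in> Proj_sparse s a"
proof -
  have card: "card T = s" and le: "\<And>i j. i \<in> T \<Longrightarrow> j \<notin> T \<Longrightarrow> (a $ j)\<^sup>2 \<le> (a $ i)\<^sup>2"
    using T by (auto simp: largest_sets_def abs_le_square_iff)
  have "{i. p $ i \<noteq> 0} \<subseteq> T"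
    using p(2) by auto
  then have "card {i. p $ i \<noteq> 0} \<le> card T"
    by (intro card_mono) auto
  then have sparse: "p \<in> sparse_set s"
    by (simp add: sparse_set_def card)
  have sq: "(norm v)\<^sup>2 = (\<Sum>i\<in>UNIV. (v $ i)\<^sup>2)" for v :: "real^'n"
    unfolding power2_norm_eq_inner inner_vec_def by (simp add: power2_eq_square)
  have "norm (p - a) \<le> norm (q - a)" if "q \<in> sparse_set s" for q
  proof -
    let ?Q = "{i. q $ i \<noteq> 0}"
    have "card (?Q - T) + card (?Q \<inter> T) = card ?Q" "card (T - ?Q) + card (?Q \<inter> T) = card T"
      by (subst card_Un_disjoint[symmetric], auto intro: arg_cong[of _ _ card])+
    then have "card (?Q - T) \<le> card (T - ?Q)"
      using that card by (simp add: sparse_set_def)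
    then obtain f where f: "inj_on f (?Q - T)" "f ` (?Q - T) \<subseteq> T - ?Q"
      using card_le_inj[of "?Q - T" "T - ?Q"] by auto
    have "(\<Sum>i\<in>?Q - T. (a $ i)\<^sup>2) \<le> (\<Sum>i\<in>?Q - T. (a $ f i)\<^sup>2)"
      using f(2) by (intro sum_mono le) auto
    also have "\<dots> = (\<Sum>i\<in>f ` (?Q - T). (a $ i)\<^sup>2)"
      using f(1) by (simp add: sum.reindex)
    also have "\<dots> \<le> (\<Sum>i\<in>T - ?Q. (a $ i)\<^sup>2)"
      using f(2) by (intro sum_mono2) auto
    finally have swap: "(\<Sum>i\<in>?Q - T. (a $ i)\<^sup>2) \<le> (\<Sum>i\<in>T - ?Q. (a $ i)\<^sup>2)" .
    have "(norm (p - a))\<^sup>2 = (\<Sum>i\<in>-T. (a $ i)\<^sup>2)"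
      unfolding sq by (intro sum.mono_neutral_cong_right) (auto simp: p)
    also have "\<dots> = (\<Sum>i\<in>?Q - T. (a $ i)\<^sup>2) + (\<Sum>i\<in>- (?Q \<union> T). (a $ i)\<^sup>2)"
      by (subst sum.union_disjoint[symmetric]) (auto intro: sum.cong)
    also have "\<dots> \<le> (\<Sum>i\<in>T - ?Q. (a $ i)\<^sup>2) + (\<Sum>i\<in>- (?Q \<union> T). (a $ i)\<^sup>2)"
      using swap by simp
    also have "\<dots> = (\<Sum>i\<in>- ?Q. (a $ i)\<^sup>2)"
      by (subst sum.union_disjoint[symmetric]) (auto intro: sum.cong)
    also have "\<dots> = (\<Sum>i\<in>- ?Q. ((q - a) $ i)\<^sup>2)"
      by (intro sum.cong) auto
    also have "\<dots> \<le> (norm (q - a))\<^sup>2"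
      unfolding sq by (intro sum_mono2) auto
    finally show ?thesis
      by (rule power2_le_imp_le) simp
  qed
  then show ?thesis
    using sparse by (auto simp: Proj_sparse_def is_arg_min_def not_less)
qed

text \<open>
  The loss \<open>J\<close> is only lower semicontinuous, but that is the direction needed: the limit has at
  most as many positive entries as the late members of the sequence.
\<close>
lemma approximate_prox_limit:
  fixes \<xi> :: "nat \<Rightarrow> real^'m"
  assumes \<xi>: "\<xi> \<longlonglongrightarrow> \<xi>'" and z: "z \<longlonglongrightarrow> z'" and \<theta>: "\<theta> \<longlonglongrightarrow> 0" and "lam > 0"
    and le: "\<And>n q. prox_objective \<beta> lam (\<xi> n + \<beta> *\<^sub>R z n) (\<xi> n)
                 \<le> prox_objective \<beta> lam (\<xi> n + \<beta> *\<^sub>R z n) q + \<theta> n"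
  shows "\<xi>' \<in> Prox_J \<beta> lam (\<xi>' + \<beta> *\<^sub>R z')"
proof -
  have "\<forall>\<^sub>F n in sequentially. \<forall>i. 0 < \<xi>' $ i \<longrightarrow> 0 < \<xi> n $ i"
  proof (rule eventually_all_finite)
    fix i
    show "\<forall>\<^sub>F n in sequentially. 0 < \<xi>' $ i \<longrightarrow> 0 < \<xi> n $ i"
      using order_tendstoD(1)[OF tendsto_vec_nth[OF \<xi>], of 0 i]
      by (cases "0 < \<xi>' $ i") auto
  qed
  then have lsc: "\<forall>\<^sub>F n in sequentially. J \<xi>' \<le> J (\<xi> n)"
    by eventually_elim (auto simp: J_def heaviside_def intro!: sum_mono)
  have "prox_objective \<beta> lam (\<xi>' + \<beta> *\<^sub>R z') \<xi>' \<le> prox_objective \<beta> lam (\<xi>' + \<beta> *\<^sub>R z') q" for q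
  proof (rule tendsto_le)
    show "(\<lambda>n. lam * J \<xi>' + 1 / (2 * \<beta>) * (norm (\<xi> n - (\<xi> n + \<beta> *\<^sub>R z n)))\<^sup>2)
        \<longlonglongrightarrow> prox_objective \<beta> lam (\<xi>' + \<beta> *\<^sub>R z') \<xi>'"
      unfolding prox_objective_def by (intro tendsto_intros \<xi> z)
    show "(\<lambda>n. prox_objective \<beta> lam (\<xi> n + \<beta> *\<^sub>R z n) q + \<theta> n)
        \<longlonglongrightarrow> prox_objective \<beta> lam (\<xi>' + \<beta> *\<^sub>R z') q"
    proof -
      have "(\<lambda>n. prox_objective \<beta> lam (\<xi> n + \<beta> *\<^sub>R z n) q + \<theta> n)
          \<longlonglongrightarrow> prox_objective \<beta> lam (\<xi>' + \<beta> *\<^sub>R z') q + 0"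
        unfolding prox_objective_def by (intro tendsto_intros \<xi> z \<theta>)
      then show ?thesis
        by simp
    qed
    show "\<forall>\<^sub>F n in sequentially. lam * J \<xi>' + 1 / (2 * \<beta>) * (norm (\<xi> n - (\<xi> n + \<beta> *\<^sub>R z n)))\<^sup>2
        \<le> prox_objective \<beta> lam (\<xi> n + \<beta> *\<^sub>R z n) q + \<theta> n"
      using lsc
    proof eventually_elim
      case (elim n)
      then have "lam * J \<xi>' \<le> lam * J (\<xi> n)"
        using \<open>lam > 0\<close> by simp
      then show ?case
        using le[of n q] by (simp add: prox_objective_def[of _ _ _ "\<xi> n"])
    qed
  qed simp
  then show ?thesis
    by (auto simp: Prox_J_def is_arg_min_def not_less)
qed

section \<open>Sequences with vanishing steps and finitely many cluster points\<close>

text \<open>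
  If such a sequence left a small ball around one of its cluster points infinitely often, then,
  as its steps are eventually shorter than the width of a surrounding annulus, it would visit that
  compact annulus infinitely often and have a further cluster point there.
\<close>
lemma convergent_if_finite_cluster_points:
  fixes X :: "nat \<Rightarrow> 'a :: {real_normed_vector, heine_borel}"
  assumes bounded: "bounded (range X)" and steps: "(\<lambda>n. X (Suc n) - X n) \<longlonglongrightarrow> 0"
    and "finite F" and F: "\<And>r l. strict_mono r \<Longrightarrow> (X \<circ> r) \<longlonglongrightarrow> l \<Longrightarrow> l \<in> F"
  shows "\<exists>l\<in>F. X \<longlonglongrightarrow> l"
proof -
  obtain l r where r: "strict_mono r" "(X \<circ> r) \<longlonglongrightarrow> l"
    using bounded_imp_convergent_subsequence[OF bounded] by blast
  obtain d where "d > 0" and d: "\<And>x. x \<in> F \<Longrightarrow> x \<noteq> l \<Longrightarrow> d \<le> dist l x"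
    using finite_set_avoid[OF \<open>finite F\<close>, of l] by blast
  have "X \<longlonglongrightarrow> l"
  proof (rule ccontr)
    assume "\<not> X \<longlonglongrightarrow> l"
    then obtain e' where "e' > 0" and far': "\<And>N. \<exists>n\<ge>N. e' \<le> dist (X n) l"
      unfolding lim_sequentially not_all not_ex not_imp not_less by blast
    \<comment> \<open>The annulus must stay away from the other points of \<open>F\<close>, which have distance at least \<open>d\<close>.\<close>
    define e where "e = min e' (d / 2)"
    have "e > 0" "e < d"
      using \<open>e' > 0\<close> \<open>d > 0\<close> by (auto simp: e_def)
    have far: "\<exists>n\<ge>N. e \<le> dist (X n) l" for N
      using far'[of N] by (auto simp: e_def)
    obtain N where N: "\<And>n. n \<ge> N \<Longrightarrow> norm (X (Suc n) - X n) < e / 2"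
      using LIMSEQ_D[OF steps, of "e / 2"] \<open>e > 0\<close> by auto
    have annulus: "\<exists>m>M. e / 2 \<le> dist (X m) l \<and> dist (X m) l \<le> e" for M
    proof -
      obtain K where K: "\<And>k. k \<ge> K \<Longrightarrow> dist ((X \<circ> r) k) l < e / 2"
        using r(2)[unfolded lim_sequentially, rule_format, of "e / 2"] \<open>e > 0\<close> by auto
      define n where "n = r (max K (max N M))"
      have n: "N \<le> n" "M \<le> n" "dist (X n) l < e / 2"
        using K[of "max K (max N M)"] strict_mono_imp_increasing[OF r(1), of "max K (max N M)"]
        by (auto simp: n_def)
      define m where "m = (LEAST m. n \<le> m \<and> e / 2 \<le> dist (X m) l)"
      have ex: "\<exists>m\<ge>n. e / 2 \<le> dist (X m) l"
      proof -
        obtain m where "n \<le> m" "e \<le> dist (X m) l"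
          using far[of n] by blast
        then show ?thesis
          using \<open>e > 0\<close> by (intro exI[of _ m]) simp
      qed
      then have "n \<le> m \<and> e / 2 \<le> dist (X m) l"
        unfolding m_def by (rule LeastI_ex)
      then have m: "n \<le> m" "e / 2 \<le> dist (X m) l"
        by auto
      then have "m \<noteq> n"
        using n(3) by auto
      then obtain j where j: "m = Suc j" "n \<le> j"
        using m(1) by (cases m) auto
      have "dist (X j) l < e / 2"
        using not_less_Least[of j "\<lambda>m. n \<le> m \<and> e / 2 \<le> dist (X m) l"] j
        unfolding m_def[symmetric] by auto
      moreover have "dist (X m) (X j) < e / 2"
        using N[of j] j n(1) by (simp add: dist_norm)
      ultimately have "dist (X m) l \<le> e"
        using dist_triangle[of "X m" l "X j"] by simp
      then show ?thesis
        using m n(2) \<open>m \<noteq> n\<close> by (intro exI[of _ m]) auto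
    qed
    let ?S = "{m. e / 2 \<le> dist (X m) l \<and> dist (X m) l \<le> e}"
    have "infinite ?S"
      unfolding infinite_nat_iff_unbounded using annulus by blast
    then obtain r1 :: "nat \<Rightarrow> nat" where r1: "strict_mono r1" "\<And>n. r1 n \<in> ?S"
      using infinite_enumerate by blast
    have "bounded (range (X \<circ> r1))"
      using bounded by (rule bounded_subset) auto
    then obtain l' r2 where r2: "strict_mono r2" "(X \<circ> r1 \<circ> r2) \<longlonglongrightarrow> l'"
      using bounded_imp_convergent_subsequence by blast
    have "l' \<in> F"
      using r1(1) r2 F[of "r1 \<circ> r2"] by (simp add: strict_mono_o o_assoc)
    have dist: "(\<lambda>n. dist ((X \<circ> r1 \<circ> r2) n) l) \<longlonglongrightarrow> dist l' l"
      by (intro tendsto_intros r2)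
    have "e / 2 \<le> dist l' l" "dist l' l \<le> e"
      by (rule LIMSEQ_le_const[OF dist] LIMSEQ_le_const2[OF dist]; use r1(2) in simp)+
    moreover have "l' \<noteq> l"
      using \<open>e / 2 \<le> dist l' l\<close> \<open>e > 0\<close> by auto
    ultimately show False
      using d[OF \<open>l' \<in> F\<close>] \<open>e > 0\<close> \<open>e < d\<close> by (auto simp: dist_commute)
  qed
  then show ?thesis
    using F[OF r] by blast
qed

lemma constant_colour_subsequence:
  fixes c :: "nat \<Rightarrow> 'c :: finite"
  shows "\<exists>r c0. strict_mono (r :: nat \<Rightarrow> nat) \<and> (\<forall>n. c (r n) = c0)"
proof -
  obtain n0 where "infinite {n \<in> UNIV. c n = c n0}"
    using pigeonhole_infinite[of UNIV c] by auto
  then obtain r :: "nat \<Rightarrow> nat" where "strict_mono r" "\<And>n. r n \<in> {n \<in> UNIV. c n = c n0}"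
    using infinite_enumerate by blast
  then show ?thesis
    by (intro exI[of _ r] exI[of _ "c n0"]) simp
qed

section \<open>The partial gradients\<close>

lemma gradient_eqI:
  assumes "GDERIV f x :> D"
  shows "gradient f x = D"
  unfolding gradient_def
proof (rule the_equality)
  fix D'
  assume "GDERIV f x :> D'"
  then have "(\<lambda>h. inner h D') = (\<lambda>h. inner h D)"
    using assms unfolding gderiv_def by (intro has_derivative_unique)
  from fun_cong[OF this, of "D' - D"]
  have "inner (D' - D) (D' - D) = 0"
    by (simp add: inner_diff_right)
  then show "D' = D"
    by simp
qed (fact assms)

lemma inner_transpose: "h \<bullet> (transpose A *v p) = p \<bullet> (A *v h)"
  for A :: "real^'n^'m"
  unfolding inner_matrix_vector[of p] by (rule inner_commute)

lemma has_derivative_half_norm_sq: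
  fixes f :: "'a::real_inner \<Rightarrow> 'b::real_inner"
  assumes "(f has_derivative f') (at x)"
  shows "((\<lambda>x. c/2 * (norm (f x))\<^sup>2) has_derivative (\<lambda>h. c * (f x \<bullet> f' h))) (at x)"
proof -
  have "((\<lambda>x. c/2 * (f x \<bullet> f x)) has_derivative (\<lambda>h. c/2 * (f x \<bullet> f' h + f' h \<bullet> f x))) (at x)"
    by (intro has_derivative_mult_right has_derivative_inner assms)
  then show ?thesis
    unfolding power2_norm_eq_inner by (rule has_derivative_eq_rhs) (simp add: inner_commute)
qed

lemma grad_w_eq:
  "grad_w A \<rho> \<mu> z v u
    = fst u + transpose A *v (z + \<rho> *\<^sub>R (A *v fst u + vec 1 - snd u)) + \<mu> *\<^sub>R (fst u - v)"
  unfolding grad_w_def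
proof (rule gradient_eqI)
  let ?r = "\<lambda>w. A *v w + vec 1 - snd u"
  have "((\<lambda>w. A *v w) has_derivative (\<lambda>h. A *v h)) (at (fst u))"
    by (intro bounded_linear_imp_has_derivative matrix_vector_mul_bounded_linear)
  then have "(?r has_derivative (\<lambda>h. A *v h + 0 - 0)) (at (fst u))"
    by (intro has_derivative_diff has_derivative_add has_derivative_const)
  then have r: "(?r has_derivative (\<lambda>h. A *v h)) (at (fst u))"
    by simp
  have "((\<lambda>w. w - v) has_derivative (\<lambda>h. h - 0)) (at (fst u))"
    by (intro has_derivative_diff has_derivative_ident has_derivative_const)
  then have v: "((\<lambda>w. w - v) has_derivative (\<lambda>h. h)) (at (fst u))"
    by simp
  have D: "((\<lambda>w. 1/2 * (norm w)\<^sup>2 + z \<bullet> ?r w + \<rho>/2 * (norm (?r w))\<^sup>2 + \<mu>/2 * (norm (w - v))\<^sup>2)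
      has_derivative (\<lambda>h. 1 * (fst u \<bullet> h) + z \<bullet> (A *v h) + \<rho> * (?r (fst u) \<bullet> (A *v h))
        + \<mu> * ((fst u - v) \<bullet> h))) (at (fst u))"
    by (intro has_derivative_add has_derivative_half_norm_sq has_derivative_inner_right r v
        has_derivative_ident)
  have eq: "1 * (fst u \<bullet> h) + z \<bullet> (A *v h) + \<rho> * (?r (fst u) \<bullet> (A *v h)) + \<mu> * ((fst u - v) \<bullet> h)
      = h \<bullet> (fst u + transpose A *v (z + \<rho> *\<^sub>R ?r (fst u)) + \<mu> *\<^sub>R (fst u - v))" for h
    by (simp only: inner_add_right inner_transpose inner_add_left inner_scaleR_left
        inner_scaleR_right inner_commute[of "fst u - v"] inner_commute[of "fst u"])
  show "GDERIV (\<lambda>w. g A \<rho> \<mu> (w, snd u) z v) (fst u)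
    :> fst u + transpose A *v (z + \<rho> *\<^sub>R ?r (fst u)) + \<mu> *\<^sub>R (fst u - v)"
    unfolding gderiv_def g_def prod.case by (rule has_derivative_eq_rhs[OF D]) (rule ext, rule eq)
qed

lemma grad_xi_eq:
  "grad_xi A \<rho> \<mu> z v u = - (z + \<rho> *\<^sub>R (A *v fst u + vec 1 - snd u))"
  unfolding grad_xi_def
proof (rule gradient_eqI)
  let ?r = "\<lambda>\<xi>. A *v fst u + vec 1 - \<xi>"
  have r: "(?r has_derivative (\<lambda>h. 0 - h)) (at (snd u))"
    by (intro has_derivative_diff has_derivative_const has_derivative_ident)
  have D: "((\<lambda>\<xi>. 1/2 * (norm (fst u))\<^sup>2 + z \<bullet> ?r \<xi> + \<rho>/2 * (norm (?r \<xi>))\<^sup>2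
        + \<mu>/2 * (norm (fst u - v))\<^sup>2)
      has_derivative (\<lambda>h. 0 + z \<bullet> (0 - h) + \<rho> * (?r (snd u) \<bullet> (0 - h)) + 0)) (at (snd u))"
    by (intro has_derivative_add has_derivative_half_norm_sq has_derivative_inner_right r
        has_derivative_const)
  have eq: "0 + z \<bullet> (0 - h) + \<rho> * (?r (snd u) \<bullet> (0 - h)) + 0
      = h \<bullet> (- (z + \<rho> *\<^sub>R ?r (snd u)))" for h
    by (simp only: inner_add_right inner_minus_right inner_scaleR_right inner_commute[of h])
      simp
  show "GDERIV (\<lambda>\<xi>. g A \<rho> \<mu> (fst u, \<xi>) z v) (snd u) :> - (z + \<rho> *\<^sub>R ?r (snd u))"
    unfolding gderiv_def g_def prod.case by (rule has_derivative_eq_rhs[OF D]) (rule ext, rule eq)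
qed

section \<open>The augmented Lagrangian\<close>

lemma mix_zero_diff: "mix C (p - q) 0 = mix C p 0 - mix C q 0"
  by (auto simp: mix_def vec_eq_iff)

lemma norm_mix_diff_le: "norm (mix C (p - q) 0) \<le> norm (mix C p 0) + norm (mix C q 0)"
  unfolding mix_zero_diff by (rule norm_triangle_ineq4)

definition aug_lagrangian ::
  "real^'n^'m \<Rightarrow> real \<Rightarrow> real \<Rightarrow> (real^'n) \<times> (real^'m) \<Rightarrow> real^'m \<Rightarrow> real" where
  "aug_lagrangian A lam \<rho> u z =
     1/2 * (norm (fst u))\<^sup>2 + z \<bullet> (A *v fst u + vec 1 - snd u)
       + \<rho>/2 * (norm (A *v fst u + vec 1 - snd u))\<^sup>2 + lam * J (snd u)"

lemma merit_eq:
  assumes "fst u \<in> sparse_set s"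
  shows "merit A s lam \<rho> \<mu> u z v
    = ereal (aug_lagrangian A lam \<rho> u z + \<mu>/2 * (norm (fst u - v))\<^sup>2)"
  using assms by (simp add: merit_def delta_sparse_def g_def aug_lagrangian_def case_prod_beta)

lemma J_nonneg: "0 \<le> J \<xi>"
  unfolding J_def by (intro sum_nonneg) (simp add: heaviside_def)

text \<open>
  Completing the square in the constraint residual \<open>r\<close> produces \<open>\<rho>/2 \<parallel>r + z/\<rho>\<parallel>\<^sup>2\<close>, which is dropped
  together with the loss term.
\<close>
lemma aug_lagrangian_ge:
  assumes "\<rho> > 0" "lam > 0"
  shows "1/2 * (norm (fst u))\<^sup>2 - (norm z)\<^sup>2 / (2 * \<rho>) \<le> aug_lagrangian A lam \<rho> u z"
proof -
  let ?r = "A *v fst u + vec 1 - snd u"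
  have "0 \<le> \<rho>/2 * ((?r + z /\<^sub>R \<rho>) \<bullet> (?r + z /\<^sub>R \<rho>))"
    using \<open>\<rho> > 0\<close> by simp
  also have "\<dots> = \<rho>/2 * (?r \<bullet> ?r) + z \<bullet> ?r + (z \<bullet> z) / (2 * \<rho>)"
  proof -
    have "(?r + z /\<^sub>R \<rho>) \<bullet> (?r + z /\<^sub>R \<rho>) = ?r \<bullet> ?r + 2 * (z \<bullet> ?r) / \<rho> + (z \<bullet> z) / \<rho>\<^sup>2"
      by (simp only: inner_add_left inner_add_right inner_scaleR_left inner_scaleR_right
          inner_commute[of ?r z]) (use \<open>\<rho> > 0\<close> in \<open>simp add: field_simps power2_eq_square\<close>)
    then show ?thesis
      using \<open>\<rho> > 0\<close> by (simp add: field_simps power2_eq_square)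
  qed
  finally show ?thesis
    using mult_nonneg_nonneg[OF less_imp_le[OF \<open>lam > 0\<close>] J_nonneg[of "snd u"]]
    by (simp add: aug_lagrangian_def power2_norm_eq_inner)
qed

section \<open>Runs of the algorithm\<close>

text \<open>
  The assumption \<open>row_bound\<close> is what the Gram matrices provide through \<open>\<gamma>\<close>. The lemmas below concern the
  iterates from index 1 on, because the initial point may violate the sparsity constraint and satisfies no
  residual condition.
\<close>
locale ipal_run =
  fixes A :: "real^'n^'m" and s :: nat
    and lam \<gamma> \<rho> \<mu> \<alpha> \<beta> c\<^sub>1 c\<^sub>2 c\<^sub>3 c\<^sub>4 :: real
    and \<theta> :: "nat \<Rightarrow> real" and u :: "nat \<Rightarrow> (real^'n) \<times> (real^'m)" and z :: "nat \<Rightarrow> real^'m"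
  assumes s_le: "s \<le> CARD('n)"
    and pos: "lam > 0" "\<gamma> > 0" "c\<^sub>1 > 0" "\<mu> > 0" "\<alpha> > 0" "\<beta> > 0"
    and row_bound: "\<And>T z. s div 2 \<le> card T \<Longrightarrow> \<gamma> * norm z \<le> norm (mix T (transpose A *v z) 0)"
    and c3: "c\<^sub>3 = (2 * c\<^sub>1 + \<mu> + 2) / \<gamma>" and c4: "c\<^sub>4 = (2 * c\<^sub>1 + \<mu>) / \<gamma>"
    and rho_ge: "\<rho> \<ge> 2 / \<gamma>\<^sup>2" "\<rho> \<ge> 8 * (c\<^sub>3\<^sup>2 + c\<^sub>4\<^sup>2) / \<mu>"
    and \<theta>: "\<theta> \<longlonglongrightarrow> 0"
    and iPAL: "iPAL_sequence A s lam \<rho> \<mu> \<alpha> \<beta> c\<^sub>1 c\<^sub>2 \<theta> u z"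
begin

abbreviation w where "w k \<equiv> fst (u k)"
abbreviation \<xi> where "\<xi> k \<equiv> snd (u k)"

definition dw where "dw k = w (Suc k) - w k"

text \<open>
  By the multiplier update, \<open>d k\<close> and \<open>- z (Suc k)\<close> are the partial gradients that enter the
  residuals of step \<open>k\<close>.
\<close>
definition d where "d k = w (Suc k) + transpose A *v z (Suc k) + \<mu> *\<^sub>R dw k"

lemma rho_pos: "\<rho> > 0"
  using rho_ge(1) pos by (smt (verit) divide_pos_pos zero_less_power)

lemma step: "iPAL_step A s lam \<rho> \<mu> \<alpha> \<beta> c\<^sub>1 c\<^sub>2 (\<theta> k) (u k) (z k) (u (Suc k)) (z (Suc k))"
  using iPAL by (simp add: iPAL_sequence_def)

lemma sparse: "w (Suc k) \<in> sparse_set s"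
  using step[of k] by (simp add: iPAL_step_def)

lemma z_Suc: "z (Suc k) = z k + \<rho> *\<^sub>R (A *v w (Suc k) + vec 1 - \<xi> (Suc k))"
  using step[of k] by (simp add: iPAL_step_def)

lemma grad_w_run: "grad_w A \<rho> \<mu> (z k) (w k) (u (Suc k)) = d k"
  unfolding grad_w_eq z_Suc[symmetric] by (simp add: d_def dw_def)

lemma grad_xi_run: "grad_xi A \<rho> \<mu> (z k) (w k) (u (Suc k)) = - z (Suc k)"
  unfolding grad_xi_eq z_Suc[symmetric] ..

lemma primal_residual:
  "\<exists>T \<in> largest_sets s (w (Suc k) - \<alpha> *\<^sub>R d k).
     norm (mix T (d k) (w (Suc k))) \<le> c\<^sub>1 * norm (dw k)"
  using step[of k] by (auto simp: iPAL_step_def R1_def grad_w_run dw_def)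

text \<open>
  At \<open>q = \<xi> (Suc k)\<close> the proximal objective is \<open>\<beta>/2 \<parallel>z (Suc k)\<parallel>\<^sup>2 + lam J(q)\<close>, so the third residual
  measures by how much \<open>\<xi>\<close> misses the minimum of its proximal problem.
\<close>
lemma prox_residual:
  "prox_objective \<beta> lam (\<xi> (Suc k) + \<beta> *\<^sub>R z (Suc k)) (\<xi> (Suc k))
     \<le> prox_objective \<beta> lam (\<xi> (Suc k) + \<beta> *\<^sub>R z (Suc k)) q + \<theta> k"
proof -
  let ?p = "prox_objective \<beta> lam (\<xi> (Suc k) + \<beta> *\<^sub>R z (Suc k))"
  have "0 \<le> ?p q" for q
    using J_nonneg[of q] pos by (simp add: prox_objective_def)
  then have "bdd_below (range ?p)"
    by (intro bdd_belowI[of _ 0]) auto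
  then have "Phi_J \<beta> lam (\<xi> (Suc k) + \<beta> *\<^sub>R z (Suc k)) \<le> ?p q"
    unfolding Phi_J_def by (intro cINF_lower) auto
  moreover have "?p (\<xi> (Suc k)) = \<beta>/2 * (norm (z (Suc k)))\<^sup>2 + lam * J (\<xi> (Suc k))"
    using pos by (simp add: prox_objective_def power2_eq_square field_simps)
  moreover have "R3 A lam \<rho> \<mu> \<beta> (z k) (w k) (u (Suc k)) \<le> \<theta> k"
    using step[of k] by (simp add: iPAL_step_def)
  ultimately show ?thesis
    by (simp add: R3_def grad_xi_run)
qed

lemma transpose_z: "transpose A *v z (Suc k) = d k - (w (Suc k) + \<mu> *\<^sub>R dw k)"
  by (simp add: d_def)

lemma norm_z_le: "\<gamma> * norm (z (Suc k)) \<le> norm (w (Suc k)) + (c\<^sub>1 + \<mu>) * norm (dw k)"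
proof -
  obtain T where T: "T \<in> largest_sets s (w (Suc k) - \<alpha> *\<^sub>R d k)"
      "norm (mix T (d k) (w (Suc k))) \<le> c\<^sub>1 * norm (dw k)"
    using primal_residual by blast
  have "\<gamma> * norm (z (Suc k)) \<le> norm (mix T (transpose A *v z (Suc k)) 0)"
    using T(1) by (intro row_bound) (simp add: largest_sets_def)
  also have "\<dots> \<le> norm (mix T (d k) 0) + norm (mix T (w (Suc k) + \<mu> *\<^sub>R dw k) 0)"
    unfolding transpose_z by (rule norm_mix_diff_le)
  also have "norm (mix T (d k) 0) \<le> c\<^sub>1 * norm (dw k)"
    using norm_mix_le[of T T "d k" "w (Suc k)"] T(2) by simp
  also have "norm (mix T (w (Suc k) + \<mu> *\<^sub>R dw k) 0) \<le> norm (w (Suc k)) + \<mu> * norm (dw k)"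
    using norm_mix_le_norm norm_triangle_ineq[of "w (Suc k)" "\<mu> *\<^sub>R dw k"] pos
    by (auto intro: order_trans)
  finally show ?thesis
    by (simp add: algebra_simps)
qed

text \<open>
  The index sets \<open>T\<close>, \<open>T'\<close> of two consecutive steps have \<open>s\<close> elements each, so at least
  \<open>s div 2\<close> of them lie in \<open>T \<inter> T'\<close> or else in each of \<open>T - T'\<close> and \<open>T' - T\<close>. On the
  intersection both gradients are small and can be subtracted. On the differences, one of the two
  iterates is small because it nearly vanishes off its own index set, which makes both multipliers
  small individually.
\<close>
lemma dual_step_le:
  "norm (z (Suc (Suc k)) - z (Suc k)) \<le> c\<^sub>3 * norm (dw (Suc k)) + c\<^sub>4 * norm (dw k)"
proof -
  let ?n1 = "norm (dw (Suc k))" and ?n0 = "norm (dw k)"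
  let ?w1 = "w (Suc k)" and ?w2 = "w (Suc (Suc k))"
  have w2: "?w2 = ?w1 + dw (Suc k)"
    by (simp add: dw_def)
  obtain T where T: "T \<in> largest_sets s (?w2 - \<alpha> *\<^sub>R d (Suc k))"
      "norm (mix T (d (Suc k)) ?w2) \<le> c\<^sub>1 * ?n1"
    using primal_residual by blast
  obtain T' where T': "T' \<in> largest_sets s (?w1 - \<alpha> *\<^sub>R d k)"
      "norm (mix T' (d k) ?w1) \<le> c\<^sub>1 * ?n0"
    using primal_residual by blast
  have card: "card T = s" "card T' = s"
    using T(1) T'(1) by (auto simp: largest_sets_def)
  have d1: "norm (mix C (d (Suc k)) 0) \<le> c\<^sub>1 * ?n1" if "C \<subseteq> T" for C
    using norm_mix_le[OF that, of "d (Suc k)" ?w2] T(2) by simp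
  have d0: "norm (mix C (d k) 0) \<le> c\<^sub>1 * ?n0" if "C \<subseteq> T'" for C
    using norm_mix_le[OF that, of "d k" ?w1] T'(2) by simp
  have small: "norm (mix C (a *\<^sub>R dw (Suc k) - b *\<^sub>R dw k) 0) \<le> a * ?n1 + b * ?n0"
    if "0 \<le> a" "0 \<le> b" for C a b
    using norm_mix_le_norm[of C "a *\<^sub>R dw (Suc k) - b *\<^sub>R dw k"]
      norm_triangle_ineq4[of "a *\<^sub>R dw (Suc k)" "b *\<^sub>R dw k"] that by simp
  have slack: "0 \<le> c\<^sub>1 * ?n1 + c\<^sub>1 * ?n0 + ?n1"
    using pos by simp
  have "\<gamma> * norm (z (Suc (Suc k)) - z (Suc k)) \<le> (2 * c\<^sub>1 + \<mu> + 2) * ?n1 + (2 * c\<^sub>1 + \<mu>) * ?n0"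
  proof (cases "s div 2 \<le> card (T \<inter> T')")
    case True
    let ?C = "T \<inter> T'"
    have "\<gamma> * norm (z (Suc (Suc k)) - z (Suc k))
        \<le> norm (mix ?C (transpose A *v (z (Suc (Suc k)) - z (Suc k))) 0)"
      using True by (rule row_bound)
    also have "transpose A *v (z (Suc (Suc k)) - z (Suc k))
        = (d (Suc k) - d k) - ((1 + \<mu>) *\<^sub>R dw (Suc k) - \<mu> *\<^sub>R dw k)"
      by (simp add: matrix_vector_mult_diff_distrib transpose_z w2 algebra_simps)
    also have "norm (mix ?C \<dots> 0) \<le> (c\<^sub>1 * ?n1 + c\<^sub>1 * ?n0) + ((1 + \<mu>) * ?n1 + \<mu> * ?n0)"
      using norm_mix_diff_le[of ?C "d (Suc k) - d k" "(1 + \<mu>) *\<^sub>R dw (Suc k) - \<mu> *\<^sub>R dw k"]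
        norm_mix_diff_le[of ?C "d (Suc k)" "d k"] d1[of ?C] d0[of ?C] small[of "1 + \<mu>" \<mu> ?C] pos
      by auto
    finally show ?thesis
      using slack by (simp add: algebra_simps)
  next
    case False
    have "card (T - T') + card (T \<inter> T') = s" "card (T' - T) + card (T \<inter> T') = s"
      using card_Int_Diff[of T T'] card_Int_Diff[of T' T] card by (auto simp: Int_commute)
    then have large: "s div 2 \<le> card (T - T')" "s div 2 \<le> card (T' - T)"
      using False by linarith+
    let ?C = "T - T'"
    have "\<gamma> * norm (z (Suc (Suc k))) \<le> norm (mix ?C (transpose A *v z (Suc (Suc k))) 0)"
      using large(1) by (rule row_bound)
    also have "transpose A *v z (Suc (Suc k))
        = (d (Suc k) - ?w1) - ((1 + \<mu>) *\<^sub>R dw (Suc k) - 0 *\<^sub>R dw k)"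
      by (simp add: transpose_z w2 algebra_simps)
    also have "norm (mix ?C \<dots> 0) \<le> (c\<^sub>1 * ?n1 + c\<^sub>1 * ?n0) + ((1 + \<mu>) * ?n1 + 0 * ?n0)"
    proof -
      have "norm (mix ?C ?w1 0) \<le> c\<^sub>1 * ?n0"
        by (rule order_trans[OF norm_mix_compl_le T'(2)]) blast
      then show ?thesis
        using norm_mix_diff_le[of ?C "d (Suc k) - ?w1" "(1 + \<mu>) *\<^sub>R dw (Suc k) - 0 *\<^sub>R dw k"]
          norm_mix_diff_le[of ?C "d (Suc k)" ?w1] d1[of ?C] small[of "1 + \<mu>" 0 ?C] pos
        by auto
    qed
    finally have z2: "\<gamma> * norm (z (Suc (Suc k))) \<le> c\<^sub>1 * ?n1 + c\<^sub>1 * ?n0 + (1 + \<mu>) * ?n1"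
      by simp
    let ?C = "T' - T"
    have "\<gamma> * norm (z (Suc k)) \<le> norm (mix ?C (transpose A *v z (Suc k)) 0)"
      using large(2) by (rule row_bound)
    also have "transpose A *v z (Suc k) = (d k - ?w2) - (- (1 *\<^sub>R dw (Suc k) - \<mu> *\<^sub>R dw k))"
      by (simp add: transpose_z w2 algebra_simps)
    also have "norm (mix ?C \<dots> 0) \<le> (c\<^sub>1 * ?n0 + c\<^sub>1 * ?n1) + (1 * ?n1 + \<mu> * ?n0)"
    proof -
      have "norm (mix ?C ?w2 0) \<le> c\<^sub>1 * ?n1"
        by (rule order_trans[OF norm_mix_compl_le T(2)]) blast
      moreover have "mix ?C (- (1 *\<^sub>R dw (Suc k) - \<mu> *\<^sub>R dw k)) 0
          = - mix ?C (1 *\<^sub>R dw (Suc k) - \<mu> *\<^sub>R dw k) 0"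
        by (auto simp: mix_def vec_eq_iff)
      ultimately show ?thesis
        using norm_mix_diff_le[of ?C "d k - ?w2" "- (1 *\<^sub>R dw (Suc k) - \<mu> *\<^sub>R dw k)"]
          norm_mix_diff_le[of ?C "d k" ?w2] d0[of ?C] small[of 1 \<mu> ?C] pos
        by auto
    qed
    finally have z1: "\<gamma> * norm (z (Suc k)) \<le> c\<^sub>1 * ?n0 + c\<^sub>1 * ?n1 + (?n1 + \<mu> * ?n0)"
      by simp
    have "\<gamma> * norm (z (Suc (Suc k)) - z (Suc k)) \<le> \<gamma> * (norm (z (Suc (Suc k))) + norm (z (Suc k)))"
      using pos by (intro mult_left_mono norm_triangle_ineq4) auto
    then show ?thesis
      using z1 z2 by (simp add: algebra_simps)
  qed
  also have "\<dots> = \<gamma> * (c\<^sub>3 * ?n1 + c\<^sub>4 * ?n0)"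
    using pos by (simp add: c3 c4 distrib_left)
  finally show ?thesis
    using pos by simp
qed

section \<open>A Lyapunov function\<close>

text \<open>
  The augmented Lagrangian decreases in the primal step and increases by
  \<open>\<parallel>z\<^sub>k\<^sub>+\<^sub>1 - z\<^sub>k\<parallel>\<^sup>2 / \<rho>\<close> in the dual step, which is controlled by the last two primal steps. The
  second term absorbs the older one.
\<close>
definition lyapunov :: "nat \<Rightarrow> real" where
  "lyapunov k = aug_lagrangian A lam \<rho> (u (Suc k)) (z (Suc k)) + 2 * c\<^sub>4\<^sup>2 / \<rho> * (norm (dw k))\<^sup>2"

lemma aug_lagrangian_step:
  "aug_lagrangian A lam \<rho> (u (Suc (Suc k))) (z (Suc (Suc k))) + \<mu>/2 * (norm (dw (Suc k)))\<^sup>2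
     \<le> aug_lagrangian A lam \<rho> (u (Suc k)) (z (Suc k)) + (norm (z (Suc (Suc k)) - z (Suc k)))\<^sup>2 / \<rho>"
proof -
  let ?r = "A *v w (Suc (Suc k)) + vec 1 - \<xi> (Suc (Suc k))"
  have "merit A s lam \<rho> \<mu> (u (Suc (Suc k))) (z (Suc k)) (w (Suc k))
      \<le> merit A s lam \<rho> \<mu> (u (Suc k)) (z (Suc k)) (w (Suc k))"
    using step[of "Suc k"] by (simp add: iPAL_step_def)
  then have "aug_lagrangian A lam \<rho> (u (Suc (Suc k))) (z (Suc k)) + \<mu>/2 * (norm (dw (Suc k)))\<^sup>2
      \<le> aug_lagrangian A lam \<rho> (u (Suc k)) (z (Suc k))"
    by (simp add: merit_eq sparse dw_def)
  moreover have "aug_lagrangian A lam \<rho> (u (Suc (Suc k))) (z (Suc (Suc k)))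
      = aug_lagrangian A lam \<rho> (u (Suc (Suc k))) (z (Suc k)) + \<rho> * (?r \<bullet> ?r)"
    unfolding aug_lagrangian_def by (subst z_Suc) (simp add: inner_add_left)
  moreover have "\<rho> * (?r \<bullet> ?r) = (norm (z (Suc (Suc k)) - z (Suc k)))\<^sup>2 / \<rho>"
    using rho_pos by (subst z_Suc) (simp add: power_mult_distrib power2_norm_eq_inner power2_eq_square[of \<rho>])
  ultimately show ?thesis
    by simp
qed

lemma lyapunov_decrease: "lyapunov (Suc k) + \<mu>/4 * (norm (dw (Suc k)))\<^sup>2 \<le> lyapunov k"
proof -
  let ?a = "norm (dw (Suc k))" and ?b = "norm (dw k)"
  have "(norm (z (Suc (Suc k)) - z (Suc k)))\<^sup>2 \<le> (c\<^sub>3 * ?a + c\<^sub>4 * ?b)\<^sup>2"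
    by (intro power_mono dual_step_le) simp
  also have "\<dots> \<le> 2 * c\<^sub>3\<^sup>2 * ?a\<^sup>2 + 2 * c\<^sub>4\<^sup>2 * ?b\<^sup>2"
    using zero_le_power2[of "c\<^sub>3 * ?a - c\<^sub>4 * ?b"] by (simp add: power2_eq_square algebra_simps)
  finally have "(norm (z (Suc (Suc k)) - z (Suc k)))\<^sup>2 / \<rho>
      \<le> (2 * c\<^sub>3\<^sup>2 * ?a\<^sup>2 + 2 * c\<^sub>4\<^sup>2 * ?b\<^sup>2) / \<rho>"
    using rho_pos by (intro divide_right_mono) auto
  also have "\<dots> = 2 * (c\<^sub>3\<^sup>2 + c\<^sub>4\<^sup>2) / \<rho> * ?a\<^sup>2 - 2 * c\<^sub>4\<^sup>2 / \<rho> * ?a\<^sup>2 + 2 * c\<^sub>4\<^sup>2 / \<rho> * ?b\<^sup>2"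
    by (simp add: add_divide_distrib algebra_simps)
  finally have "(norm (z (Suc (Suc k)) - z (Suc k)))\<^sup>2 / \<rho>
      \<le> 2 * (c\<^sub>3\<^sup>2 + c\<^sub>4\<^sup>2) / \<rho> * ?a\<^sup>2 - 2 * c\<^sub>4\<^sup>2 / \<rho> * ?a\<^sup>2 + 2 * c\<^sub>4\<^sup>2 / \<rho> * ?b\<^sup>2" .
  moreover have "2 * (c\<^sub>3\<^sup>2 + c\<^sub>4\<^sup>2) / \<rho> \<le> \<mu> / 4"
    using rho_ge(2) rho_pos pos by (simp add: field_simps)
  then have "2 * (c\<^sub>3\<^sup>2 + c\<^sub>4\<^sup>2) / \<rho> * ?a\<^sup>2 \<le> \<mu> / 4 * ?a\<^sup>2"
    by (intro mult_right_mono) auto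
  ultimately show ?thesis
    using aug_lagrangian_step[of k] unfolding lyapunov_def by simp
qed

text \<open>
  Completing the square in the augmented Lagrangian leaves \<open>- \<parallel>z\<parallel>\<^sup>2 / (2 \<rho>)\<close>. The multiplier is
  bounded through the row bound, and \<open>(a + b)\<^sup>2 \<le> 3/2 a\<^sup>2 + 3 b\<^sup>2\<close> is weighted so that, as
  \<open>\<rho> \<gamma>\<^sup>2 \<ge> 2\<close>, a positive multiple of \<open>\<parallel>w\<parallel>\<^sup>2\<close> survives.
\<close>
lemma lyapunov_ge: "1/8 * (norm (w (Suc k)))\<^sup>2 \<le> lyapunov k"
proof -
  let ?a = "norm (w (Suc k))" and ?b = "norm (dw k)"
  have \<gamma>\<rho>: "2 \<le> \<rho> * \<gamma>\<^sup>2"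
    using rho_ge(1) pos by (simp add: field_simps)
  have "(\<gamma> * norm (z (Suc k)))\<^sup>2 \<le> (?a + (c\<^sub>1 + \<mu>) * ?b)\<^sup>2"
    using pos by (intro power_mono norm_z_le) auto
  also have "\<dots> \<le> 3/2 * ?a\<^sup>2 + 3 * ((c\<^sub>1 + \<mu>) * ?b)\<^sup>2"
    using zero_le_power2[of "?a - 2 * ((c\<^sub>1 + \<mu>) * ?b)"] by (simp add: power2_eq_square algebra_simps)
  also have "((c\<^sub>1 + \<mu>) * ?b)\<^sup>2 \<le> ((2 * c\<^sub>1 + \<mu>) * ?b)\<^sup>2"
    using pos by (intro power_mono mult_right_mono) auto
  also have "(2 * c\<^sub>1 + \<mu>) * ?b = \<gamma> * c\<^sub>4 * ?b"
    using pos by (simp add: c4)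
  finally have "(\<gamma> * norm (z (Suc k)))\<^sup>2 / (2 * (\<rho> * \<gamma>\<^sup>2))
      \<le> (3/2 * ?a\<^sup>2 + 3 * (\<gamma> * c\<^sub>4 * ?b)\<^sup>2) / (2 * (\<rho> * \<gamma>\<^sup>2))"
    using \<gamma>\<rho> by (intro divide_right_mono) auto
  also have "\<dots> = (3/2 * ?a\<^sup>2) / (2 * (\<rho> * \<gamma>\<^sup>2)) + 3/2 * c\<^sub>4\<^sup>2 / \<rho> * ?b\<^sup>2"
    using pos rho_pos by (simp add: power_mult_distrib field_simps)
  also have "(3/2 * ?a\<^sup>2) / (2 * (\<rho> * \<gamma>\<^sup>2)) \<le> (3/2 * ?a\<^sup>2) / 4"
    using \<gamma>\<rho> by (intro divide_left_mono) auto
  also have "3/2 * c\<^sub>4\<^sup>2 / \<rho> * ?b\<^sup>2 \<le> 2 * c\<^sub>4\<^sup>2 / \<rho> * ?b\<^sup>2"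
    using rho_pos by (intro mult_right_mono divide_right_mono) auto
  also have "(\<gamma> * norm (z (Suc k)))\<^sup>2 / (2 * (\<rho> * \<gamma>\<^sup>2)) = (norm (z (Suc k)))\<^sup>2 / (2 * \<rho>)"
    using pos by (simp add: power_mult_distrib)
  finally show ?thesis
    using aug_lagrangian_ge[OF rho_pos pos(1), of "u (Suc k)" "z (Suc k)" A]
    unfolding lyapunov_def by simp
qed

lemma lyapunov_decseq: "decseq lyapunov"
proof (rule decseq_SucI)
  fix k
  have "0 \<le> \<mu>/4 * (norm (dw (Suc k)))\<^sup>2"
    using pos by simp
  then show "lyapunov (Suc k) \<le> lyapunov k"
    using lyapunov_decrease[of k] by linarith
qed

lemma dw_tendsto_0: "dw \<longlonglongrightarrow> 0"
proof -
  have "0 \<le> lyapunov k" for k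
    by (rule order_trans[OF _ lyapunov_ge]) simp
  then obtain L where L: "lyapunov \<longlonglongrightarrow> L"
    using decseq_convergent[OF lyapunov_decseq, of 0] by blast
  have "(\<lambda>k. 4 / \<mu> * (lyapunov k - lyapunov (Suc k))) \<longlonglongrightarrow> 4 / \<mu> * (L - L)"
    by (intro tendsto_intros L LIMSEQ_Suc)
  then have "(\<lambda>k. 4 / \<mu> * (lyapunov k - lyapunov (Suc k))) \<longlonglongrightarrow> 0"
    by simp
  then have "(\<lambda>k. (norm (dw (Suc k)))\<^sup>2) \<longlonglongrightarrow> 0"
  proof (rule Lim_null_comparison[rotated], intro always_eventually allI)
    fix k
    show "norm ((norm (dw (Suc k)))\<^sup>2) \<le> 4 / \<mu> * (lyapunov k - lyapunov (Suc k))"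
      using lyapunov_decrease[of k] pos by (simp add: field_simps)
  qed
  then have "(\<lambda>k. sqrt ((norm (dw (Suc k)))\<^sup>2)) \<longlonglongrightarrow> sqrt 0"
    by (rule tendsto_real_sqrt)
  then have "(\<lambda>k. dw (Suc k)) \<longlonglongrightarrow> 0"
    by (simp add: tendsto_norm_zero_iff)
  then show ?thesis
    by (rule LIMSEQ_imp_Suc)
qed

lemma z_step_tendsto_0: "(\<lambda>k. z (Suc (Suc k)) - z (Suc k)) \<longlonglongrightarrow> 0"
proof (rule Lim_null_comparison)
  show "\<forall>\<^sub>F k in sequentially. norm (z (Suc (Suc k)) - z (Suc k))
      \<le> c\<^sub>3 * norm (dw (Suc k)) + c\<^sub>4 * norm (dw k)"
    by (simp add: dual_step_le)
  have "(\<lambda>k. c\<^sub>3 * norm (dw (Suc k)) + c\<^sub>4 * norm (dw k)) \<longlonglongrightarrow> c\<^sub>3 * norm (0 :: real^'n) + c\<^sub>4 * norm (0 :: real^'n)"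
    by (intro tendsto_intros LIMSEQ_Suc dw_tendsto_0)
  then show "(\<lambda>k. c\<^sub>3 * norm (dw (Suc k)) + c\<^sub>4 * norm (dw k)) \<longlonglongrightarrow> 0"
    by simp
qed

definition r where "r k = A *v w k + vec 1 - \<xi> k"

lemma r_tendsto_0: "r \<longlonglongrightarrow> 0"
proof -
  have "(\<lambda>k. (z (Suc (Suc k)) - z (Suc k)) /\<^sub>R \<rho>) \<longlonglongrightarrow> 0 /\<^sub>R \<rho>"
    by (intro tendsto_intros z_step_tendsto_0)
  moreover have "(z (Suc (Suc k)) - z (Suc k)) /\<^sub>R \<rho> = r (Suc (Suc k))" for k
    using rho_pos by (subst z_Suc) (simp add: r_def)
  ultimately have "(\<lambda>k. r (Suc (Suc k))) \<longlonglongrightarrow> 0"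
    by simp
  then show ?thesis
    by (intro LIMSEQ_imp_Suc[of r] LIMSEQ_imp_Suc[of "\<lambda>k. r (Suc k)"])
qed

section \<open>Cluster points and convergence\<close>

text \<open>Primal and dual iterates form one sequence, so that a single limit is extracted.\<close>
definition X where "X k = (u (Suc k), z (Suc k))"

lemma xi_eq: "\<xi> k = A *v w k + vec 1 - r k"
  by (simp add: r_def)

lemma steps_tendsto_0: "(\<lambda>k. X (Suc k) - X k) \<longlonglongrightarrow> 0"
proof -
  have w: "(\<lambda>k. w (Suc (Suc k)) - w (Suc k)) \<longlonglongrightarrow> 0"
    using LIMSEQ_Suc[OF dw_tendsto_0] by (simp add: dw_def)
  have "(\<lambda>k. A *v (w (Suc (Suc k)) - w (Suc k)) - (r (Suc (Suc k)) - r (Suc k))) \<longlonglongrightarrow> A *v 0 - (0 - 0)"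
    by (intro tendsto_diff LIMSEQ_Suc r_tendsto_0 w
        bounded_linear.tendsto[OF matrix_vector_mul_bounded_linear])
  then have \<xi>: "(\<lambda>k. \<xi> (Suc (Suc k)) - \<xi> (Suc k)) \<longlonglongrightarrow> 0"
    by (simp add: xi_eq matrix_vector_mult_diff_distrib algebra_simps)
  have "X (Suc k) - X k = ((w (Suc (Suc k)) - w (Suc k), \<xi> (Suc (Suc k)) - \<xi> (Suc k)),
      z (Suc (Suc k)) - z (Suc k))" for k
    by (simp add: X_def prod_eq_iff)
  then show ?thesis
    using tendsto_Pair[OF tendsto_Pair[OF w \<xi>] z_step_tendsto_0] by (simp add: zero_prod_def)
qed

lemma bounded_X: "bounded (range X)"
proof -
  have "norm (w (Suc k)) \<le> sqrt (8 * lyapunov 0)" for k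
  proof (rule real_le_rsqrt)
    show "(norm (w (Suc k)))\<^sup>2 \<le> 8 * lyapunov 0"
      using lyapunov_ge[of k] decseqD[OF lyapunov_decseq, of 0 k] by simp
  qed
  then obtain B where B: "\<And>k. norm (w (Suc k)) \<le> B"
    by blast
  obtain D where D: "\<And>k. norm (dw k) \<le> D"
    using convergent_imp_Bseq[OF convergentI[OF dw_tendsto_0]] unfolding Bseq_def by blast
  obtain R where R: "\<And>k. norm (r k) \<le> R"
    using convergent_imp_Bseq[OF convergentI[OF r_tendsto_0]] unfolding Bseq_def by blast
  have w: "bounded (range (\<lambda>k. w (Suc k)))"
    using B by (auto simp: bounded_iff)
  have r: "bounded (range (\<lambda>k. r (Suc k)))"
    using R by (auto simp: bounded_iff)
  have "norm (z (Suc k)) \<le> (B + (c\<^sub>1 + \<mu>) * D) / \<gamma>" for k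
  proof -
    have "\<gamma> * norm (z (Suc k)) \<le> B + (c\<^sub>1 + \<mu>) * D"
    proof -
      have "(c\<^sub>1 + \<mu>) * norm (dw k) \<le> (c\<^sub>1 + \<mu>) * D"
        using D pos by (intro mult_left_mono) auto
      then show ?thesis
        using norm_z_le[of k] B[of k] by linarith
    qed
    then show ?thesis
      using pos by (simp add: field_simps)
  qed
  then have z: "bounded (range (\<lambda>k. z (Suc k)))"
    by (auto simp: bounded_iff)
  have "bounded ((*v) A ` range (\<lambda>k. w (Suc k)))"
    by (intro bounded_linear_image w matrix_vector_mul_bounded_linear)
  then have "bounded (range (\<lambda>k. A *v w (Suc k)))"
    by (simp add: image_image)
  then have \<xi>: "bounded (range (\<lambda>k. \<xi> (Suc k)))"
    unfolding xi_eq by (intro bounded_minus_comp bounded_plus_comp r) auto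
  have "range X \<subseteq> (range (\<lambda>k. w (Suc k)) \<times> range (\<lambda>k. \<xi> (Suc k))) \<times> range (\<lambda>k. z (Suc k))"
    by (rule image_subsetI) (simp add: X_def mem_Times_iff)
  then show ?thesis
    by (rule bounded_subset[rotated]) (intro bounded_Times w \<xi> z)
qed

text \<open>
  Only finitely many index sets \<open>T\<close> occur, so along a subsequence \<open>T\<close> is constant. In the limit the
  first residual then says that \<open>w'\<close> is the hard thresholding of its gradient step to \<open>T\<close>, and the
  third that \<open>\<xi>'\<close> is a proximal point.
\<close>
lemma cluster_point_P_stationary:
  assumes "strict_mono h" and lim: "(X \<circ> h) \<longlonglongrightarrow> ((w', \<xi>'), z')"
  shows "P_stationary A s lam (w', \<xi>') z'"
proof -
  obtain T where T: "\<And>k. T k \<in> largest_sets s (w (Suc k) - \<alpha> *\<^sub>R d k)"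
    and T_small: "\<And>k. norm (mix (T k) (d k) (w (Suc k))) \<le> c\<^sub>1 * norm (dw k)"
  proof -
    have "\<forall>k. \<exists>T. T \<in> largest_sets s (w (Suc k) - \<alpha> *\<^sub>R d k)
        \<and> norm (mix T (d k) (w (Suc k))) \<le> c\<^sub>1 * norm (dw k)"
      using primal_residual by blast
    from choice[OF this] show thesis
      using that by blast
  qed
  obtain h' :: "nat \<Rightarrow> nat" and T0 where h': "strict_mono h'" and T0: "\<And>n. T (h (h' n)) = T0"
    using constant_colour_subsequence[of "\<lambda>n. T (h n)"] by blast
  define q where "q = h \<circ> h'"
  have q: "strict_mono q"
    unfolding q_def by (intro strict_mono_o assms h')
  have lim: "(\<lambda>n. X (q n)) \<longlonglongrightarrow> ((w', \<xi>'), z')"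
    using LIMSEQ_subseq_LIMSEQ[OF lim h'] by (simp add: q_def o_def)
  have w: "(\<lambda>n. w (Suc (q n))) \<longlonglongrightarrow> w'" and \<xi>: "(\<lambda>n. \<xi> (Suc (q n))) \<longlonglongrightarrow> \<xi>'"
    and z: "(\<lambda>n. z (Suc (q n))) \<longlonglongrightarrow> z'"
    using tendsto_fst[OF tendsto_fst[OF lim]] tendsto_snd[OF tendsto_fst[OF lim]] tendsto_snd[OF lim]
    by (simp_all add: X_def)
  have dw: "(\<lambda>n. dw (q n)) \<longlonglongrightarrow> 0"
    using LIMSEQ_subseq_LIMSEQ[OF dw_tendsto_0 q] by (simp add: o_def)
  have r: "(\<lambda>n. r (Suc (q n))) \<longlonglongrightarrow> 0"
    using LIMSEQ_subseq_LIMSEQ[OF LIMSEQ_Suc[OF r_tendsto_0] q] by (simp add: o_def)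
  have \<theta>': "(\<lambda>n. \<theta> (q n)) \<longlonglongrightarrow> 0"
    using LIMSEQ_subseq_LIMSEQ[OF \<theta> q] by (simp add: o_def)
  define d' where "d' = w' + transpose A *v z'"
  have "(\<lambda>n. d (q n)) \<longlonglongrightarrow> w' + transpose A *v z' + \<mu> *\<^sub>R 0"
    unfolding d_def
    by (intro tendsto_intros w z dw bounded_linear.tendsto[OF matrix_vector_mul_bounded_linear])
  then have d: "(\<lambda>n. d (q n)) \<longlonglongrightarrow> d'"
    by (simp add: d'_def)
  have small: "(\<lambda>n. mix T0 (d (q n)) (w (Suc (q n)))) \<longlonglongrightarrow> 0"
  proof (rule Lim_null_comparison)
    have "norm (mix T0 (d (q n)) (w (Suc (q n)))) \<le> c\<^sub>1 * norm (dw (q n))" for n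
      using T_small[of "q n"] T0[of n] by (simp add: q_def)
    then show "\<forall>\<^sub>F n in sequentially. norm (mix T0 (d (q n)) (w (Suc (q n)))) \<le> c\<^sub>1 * norm (dw (q n))"
      by simp
    show "(\<lambda>n. c\<^sub>1 * norm (dw (q n))) \<longlonglongrightarrow> 0"
      using tendsto_mult_left[OF tendsto_norm[OF dw], of c\<^sub>1] by simp
  qed
  have d'0: "d' $ i = 0" if "i \<in> T0" for i
  proof (rule LIMSEQ_unique[OF tendsto_vec_nth[OF d]])
    show "(\<lambda>n. d (q n) $ i) \<longlonglongrightarrow> 0"
      using tendsto_vec_nth[OF small, of i] that by (simp add: mix_def)
  qed
  have w'0: "w' $ i = 0" if "i \<notin> T0" for i
  proof (rule LIMSEQ_unique[OF tendsto_vec_nth[OF w]])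
    show "(\<lambda>n. w (Suc (q n)) $ i) \<longlonglongrightarrow> 0"
      using tendsto_vec_nth[OF small, of i] that by (simp add: mix_def)
  qed
  have "T0 \<in> largest_sets s (w' - \<alpha> *\<^sub>R d')"
  proof -
    have largest: "T0 \<in> largest_sets s (w (Suc (q n)) - \<alpha> *\<^sub>R d (q n))" for n
      using T[of "q n"] T0[of n] by (simp add: q_def)
    have "\<bar>(w' - \<alpha> *\<^sub>R d') $ j\<bar> \<le> \<bar>(w' - \<alpha> *\<^sub>R d') $ i\<bar>" if "i \<in> T0" "j \<notin> T0" for i j
    proof (rule LIMSEQ_le)
      show "(\<lambda>n. \<bar>(w (Suc (q n)) - \<alpha> *\<^sub>R d (q n)) $ j\<bar>) \<longlonglongrightarrow> \<bar>(w' - \<alpha> *\<^sub>R d') $ j\<bar>"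
        "(\<lambda>n. \<bar>(w (Suc (q n)) - \<alpha> *\<^sub>R d (q n)) $ i\<bar>) \<longlonglongrightarrow> \<bar>(w' - \<alpha> *\<^sub>R d') $ i\<bar>"
        by (intro tendsto_rabs tendsto_vec_nth tendsto_diff tendsto_scaleR tendsto_const w d)+
      have "\<bar>(w (Suc (q n)) - \<alpha> *\<^sub>R d (q n)) $ j\<bar> \<le> \<bar>(w (Suc (q n)) - \<alpha> *\<^sub>R d (q n)) $ i\<bar>" for n
        using largest[of n] that unfolding largest_sets_def by blast
      then show "\<exists>N. \<forall>n\<ge>N. \<bar>(w (Suc (q n)) - \<alpha> *\<^sub>R d (q n)) $ j\<bar>
          \<le> \<bar>(w (Suc (q n)) - \<alpha> *\<^sub>R d (q n)) $ i\<bar>"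
        by blast
    qed
    then show ?thesis
      using largest by (auto simp: largest_sets_def)
  qed
  then have "w' \<in> Proj_sparse s (w' - \<alpha> *\<^sub>R d')"
    by (rule hard_threshold_in_Proj_sparse) (auto simp: d'0 w'0)
  moreover have "\<xi>' \<in> Prox_J \<beta> lam (\<xi>' + \<beta> *\<^sub>R z')"
    by (rule approximate_prox_limit[OF \<xi> z \<theta>' pos(1)]) (rule prox_residual)
  moreover have "(\<lambda>n. r (Suc (q n))) \<longlonglongrightarrow> A *v w' + vec 1 - \<xi>'"
    unfolding r_def
    by (intro tendsto_intros w \<xi> bounded_linear.tendsto[OF matrix_vector_mul_bounded_linear])
  then have "A *v w' + vec 1 - \<xi>' = 0"
    using r by (rule LIMSEQ_unique)
  ultimately show ?thesis
    unfolding P_stationary_def d'_def prod.case using pos(5,6) by blast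
qed

lemma converges:
  "\<exists>u_star z_star. u \<longlonglongrightarrow> u_star \<and> z \<longlonglongrightarrow> z_star \<and>
     P_stationary A s lam u_star z_star \<and> strict_local_minimizer A s lam u_star"
proof -
  let ?F = "{(u, z). P_stationary A s lam u z}"
  have "?F \<subseteq> {(u, z). first_order A s u z}"
    using P_stationary_first_order pos(1) by blast
  then have "finite ?F"
    by (rule finite_subset) (rule finite_first_order[OF pos(2) s_le row_bound])
  then have "\<exists>l\<in>?F. X \<longlonglongrightarrow> l"
  proof (rule convergent_if_finite_cluster_points[OF bounded_X steps_tendsto_0])
    fix h l
    assume "strict_mono h" "(X \<circ> h) \<longlonglongrightarrow> l"
    then show "l \<in> ?F"
      using cluster_point_P_stationary[of h "fst (fst l)" "snd (fst l)" "snd l"]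
      by (simp add: case_prod_beta)
  qed
  then obtain u' z' where lim: "X \<longlonglongrightarrow> (u', z')" and P: "P_stationary A s lam u' z'"
    by auto
  have "u \<longlonglongrightarrow> u'" "z \<longlonglongrightarrow> z'"
    using tendsto_fst[OF lim] tendsto_snd[OF lim] by (auto simp: X_def intro: LIMSEQ_imp_Suc)
  moreover have "strict_local_minimizer A s lam u'"
    using first_order_strict_local_minimizer P_stationary_first_order P pos(1) by blast
  ultimately show ?thesis
    using P by blast
qed

end

theorem theorem6:
  fixes x :: "'m::finite \<Rightarrow> 'n::finite \<Rightarrow> real"
    and y :: "real^'m"
    and b :: 'n
    and A :: "real^'n^'m"
    and s :: nat
    and lam \<gamma> \<rho> \<mu> \<alpha> \<beta> c\<^sub>1 c\<^sub>2 c\<^sub>3 c\<^sub>4 :: real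
    and \<theta> :: "nat \<Rightarrow> real"
    and u :: "nat \<Rightarrow> (real^'n) \<times> (real^'m)"
    and z :: "nat \<Rightarrow> real^'m"
  assumes "\<And>i. y $ i \<in> {1, -1}"
    and "A = data_matrix b x y"
    and "0 < s" and "s \<le> CARD('n)"
    and "lam > 0"
    and "\<And>T :: 'n set. card T = s div 2 \<Longrightarrow> rank (col_submatrix A T) = CARD('m)"
    and "\<gamma> > 0"
    and "\<gamma>\<^sup>2 = Min ((\<lambda>T. lambda_min (col_submatrix A T ** transpose (col_submatrix A T)))
                   ` {T :: 'n set. card T = s div 2})"
    and "c\<^sub>1 > 0" and "c\<^sub>2 > 0" and "\<mu> > 0" and "\<alpha> > 0" and "\<beta> > 0"
    and "c\<^sub>3 = (2 * c\<^sub>1 + \<mu> + 2) / \<gamma>"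
    and "c\<^sub>4 = (2 * c\<^sub>1 + \<mu>) / \<gamma>"
    and "\<rho> \<ge> max (2 / \<gamma>\<^sup>2) (8 * (c\<^sub>3\<^sup>2 + c\<^sub>4\<^sup>2) / \<mu>)"
    and "\<And>k. \<theta> k > 0" and "\<theta> \<longlonglongrightarrow> 0"
    and "iPAL_sequence A s lam \<rho> \<mu> \<alpha> \<beta> c\<^sub>1 c\<^sub>2 \<theta> u z"
  shows "\<exists>u_star z_star. u \<longlonglongrightarrow> u_star \<and> z \<longlonglongrightarrow> z_star \<and>
           P_stationary A s lam u_star z_star \<and> strict_local_minimizer A s lam u_star"
proof (rule ipal_run.converges)
  show "ipal_run A s lam \<gamma> \<rho> \<mu> \<alpha> \<beta> c\<^sub>1 c\<^sub>2 c\<^sub>3 c\<^sub>4 \<theta> u z"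
  proof
    show "\<gamma> * norm q \<le> norm (mix T (transpose A *v q) 0)" if "s div 2 \<le> card T" for T q
      using \<open>\<gamma> > 0\<close> assms(8) that by (rule restricted_row_bound)
  qed (use assms in auto)
qed

end
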